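(* Let $A$ be a left nilpotent skew left brace. Then the following statements hold: (1) The additive group of $A^2$ is locally nilpotent. (2) The quotient group $(A,\circ)/\ker\lambda$ of the multiplicative group of $A$ is locally nilpotent.
   Context: A skew left brace is a triple $(A,+,\circ)$ where $(A,+)$ and $(A,\circ)$ are (not necessarily abelian) groups such that $a\circ(b+c)=a\circ b-a+a\circ c$ for all $a,b,c\in A$. The two groups share the same neutral element $0$. The map $\lambda\colon(A,\circ)\to\mathrm{Aut}(A,+)$, $a\mapsto\lambda_a$, with $\lambda_a(b)=-a+a\circ b$, is a group homomorphism. For $a,b\in A$ put $a*b=-a+a\circ b-b$. For subsets $X,Y\subseteq A$, $X*Y$ denotes the subgroup of $(A,+)$ generated by all $x*y$ with $x\in X$, $y\in Y$. The left series of $A$ is $A^1=A$, $A^{n+1}=A*A^n$ for $n\ge 1$ (so $A^2=A*A$); $A$ is left nilpotent if $A^m=0$ for some $m\ge 1$. A group is locally nilpotent if all its finitely generated subgroups are nilpotent. *)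

theory Defs
  imports "HOL-Algebra.Ring" "HOL-Algebra.Coset" "HOL-Algebra.Bij" "HOL-Algebra.Generated_Groups"
begin

section \<open>Nilpotent and locally nilpotent groups\<close>

definition commutator_subgroup ::
    "('a, 'b) monoid_scheme \<Rightarrow> 'a set \<Rightarrow> 'a set \<Rightarrow> 'a set" where
  "commutator_subgroup G H K =
     generate G {h \<otimes>\<^bsub>G\<^esub> k \<otimes>\<^bsub>G\<^esub> inv\<^bsub>G\<^esub> h \<otimes>\<^bsub>G\<^esub> inv\<^bsub>G\<^esub> k | h k. h \<in> H \<and> k \<in> K}"

text \<open>The index is shifted by one: the value at \<open>0\<close> is the first term (the whole group).\<close>

primrec lower_central_series :: "('a, 'b) monoid_scheme \<Rightarrow> nat \<Rightarrow> 'a set" where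
  "lower_central_series G 0 = carrier G"
| "lower_central_series G (Suc n) =
     commutator_subgroup G (lower_central_series G n) (carrier G)"

definition nilpotent_group :: "('a, 'b) monoid_scheme \<Rightarrow> bool" where
  "nilpotent_group G \<longleftrightarrow> group G \<and> (\<exists>n. lower_central_series G n = {\<one>\<^bsub>G\<^esub>})"

definition locally_nilpotent_group :: "('a, 'b) monoid_scheme \<Rightarrow> bool" where
  "locally_nilpotent_group G \<longleftrightarrow> group G \<and>
     (\<forall>S. finite S \<and> S \<subseteq> carrier G \<longrightarrow> nilpotent_group (subgroup_generated G S))"


section \<open>Skew left braces\<close>

text \<open>
  A skew left brace is encoded in the record of HOL-Algebra rings, which is only used for its
  signature: \<open>\<oplus>\<close> is the (not necessarily commutative) group operation \<open>+\<close>, with neutral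
  element \<open>\<zero>\<close> and inverse \<open>\<ominus>\<close>, and \<open>\<otimes>\<close> is the operation \<open>\<circ>\<close>, with neutral element \<open>\<one>\<close>.
  That \<open>\<zero> = \<one>\<close> is a consequence of the axioms. Thus \<open>add_monoid A\<close> is the additive
  group and \<open>A\<close> itself, read as a monoid, is the multiplicative group.
\<close>

locale skew_left_brace = group A + add: group "add_monoid A" for A (structure) +
  assumes brace_distrib:
    "\<lbrakk>a \<in> carrier A; b \<in> carrier A; c \<in> carrier A\<rbrakk>
      \<Longrightarrow> a \<otimes> (b \<oplus> c) = ((a \<otimes> b) \<ominus> a) \<oplus> (a \<otimes> c)"

text \<open>
  As in \<^const>\<open>AutoGroup\<close>, automorphisms are extensional functions, whence the restriction
  to the carrier.
\<close>

definition lambda_map :: "('a, 'b) ring_scheme \<Rightarrow> 'a \<Rightarrow> 'a \<Rightarrow> 'a" where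
  "lambda_map A a = (\<lambda>b \<in> carrier A. (\<ominus>\<^bsub>A\<^esub> a) \<oplus>\<^bsub>A\<^esub> (a \<otimes>\<^bsub>A\<^esub> b))"

definition star :: "('a, 'b) ring_scheme \<Rightarrow> 'a \<Rightarrow> 'a \<Rightarrow> 'a" where
  "star A a b = ((\<ominus>\<^bsub>A\<^esub> a) \<oplus>\<^bsub>A\<^esub> (a \<otimes>\<^bsub>A\<^esub> b)) \<ominus>\<^bsub>A\<^esub> b"

definition star_set :: "('a, 'b) ring_scheme \<Rightarrow> 'a set \<Rightarrow> 'a set \<Rightarrow> 'a set" where
  "star_set A X Y = generate (add_monoid A) {star A x y | x y. x \<in> X \<and> y \<in> Y}"

text \<open>The left series starts at index \<open>1\<close>; the value at \<open>0\<close> is a dummy.\<close>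

fun left_series :: "('a, 'b) ring_scheme \<Rightarrow> nat \<Rightarrow> 'a set" where
  "left_series A 0 = carrier A"
| "left_series A (Suc 0) = carrier A"
| "left_series A (Suc (Suc n)) = star_set A (carrier A) (left_series A (Suc n))"

definition left_nilpotent :: "('a, 'b) ring_scheme \<Rightarrow> bool" where
  "left_nilpotent A \<longleftrightarrow> (\<exists>m\<ge>1. left_series A m = {\<zero>\<^bsub>A\<^esub>})"


subsection \<open>Well-definedness of the lambda map\<close>

context skew_left_brace
begin

lemma a_closed: "\<lbrakk>a \<in> carrier A; b \<in> carrier A\<rbrakk> \<Longrightarrow> a \<oplus> b \<in> carrier A"
  using add.m_closed by simp

lemma neg_closed: "a \<in> carrier A \<Longrightarrow> \<ominus> a \<in> carrier A"
  using add.inv_closed by (simp add: a_inv_def)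

lemma a_assoc:
  "\<lbrakk>a \<in> carrier A; b \<in> carrier A; c \<in> carrier A\<rbrakk> \<Longrightarrow> a \<oplus> b \<oplus> c = a \<oplus> (b \<oplus> c)"
  using add.m_assoc by simp

lemma zero_closed: "\<zero> \<in> carrier A"
  using add.one_closed by simp

lemma a_zero: "a \<in> carrier A \<Longrightarrow> \<zero> \<oplus> a = a" "a \<in> carrier A \<Longrightarrow> a \<oplus> \<zero> = a"
  using add.l_one add.r_one by simp_all

lemma a_neg: "a \<in> carrier A \<Longrightarrow> \<ominus> a \<oplus> a = \<zero>" "a \<in> carrier A \<Longrightarrow> a \<oplus> \<ominus> a = \<zero>"
  using add.l_inv add.r_inv by (simp_all add: a_inv_def)

lemma a_neg_cancel:
  assumes "a \<in> carrier A" "b \<in> carrier A"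
  shows "\<ominus> a \<oplus> (a \<oplus> b) = b" "a \<oplus> (\<ominus> a \<oplus> b) = b"
  using assms by (simp_all add: a_assoc[symmetric] a_neg a_zero neg_closed)

lemmas a_simps = a_closed neg_closed a_assoc zero_closed a_zero a_neg a_neg_cancel

lemma mult_zero:
  assumes a: "a \<in> carrier A" shows "a \<otimes> \<zero> = a"
proof -
  have "a \<otimes> \<zero> = a \<otimes> \<zero> \<oplus> (\<ominus> a \<oplus> (a \<otimes> \<zero>))"
    using brace_distrib[OF a zero_closed zero_closed] a by (simp add: a_minus_def a_simps)
  then have "\<ominus> (a \<otimes> \<zero>) \<oplus> (a \<otimes> \<zero>) = \<ominus> (a \<otimes> \<zero>) \<oplus> (a \<otimes> \<zero> \<oplus> (\<ominus> a \<oplus> (a \<otimes> \<zero>)))"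
    by simp
  then have "\<zero> = \<ominus> a \<oplus> (a \<otimes> \<zero>)"
    using a by (simp add: a_simps)
  then have "a \<oplus> \<zero> = a \<oplus> (\<ominus> a \<oplus> (a \<otimes> \<zero>))" by simp
  then show ?thesis using a by (simp add: a_simps)
qed

lemma zero_eq_one: "\<zero> = \<one>"
  using mult_zero[OF one_closed] by (simp add: zero_closed)

lemma lambda_map_add:
  assumes "a \<in> carrier A" "b \<in> carrier A" "c \<in> carrier A"
  shows "lambda_map A a (b \<oplus> c) = lambda_map A a b \<oplus> lambda_map A a c"
  using assms by (simp add: lambda_map_def brace_distrib a_minus_def a_simps)

lemma lambda_map_closed:
  "\<lbrakk>a \<in> carrier A; b \<in> carrier A\<rbrakk> \<Longrightarrow> lambda_map A a b \<in> carrier A"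
  by (simp add: lambda_map_def a_simps)

lemma mult_eq_add_lambda_map:
  "\<lbrakk>a \<in> carrier A; b \<in> carrier A\<rbrakk> \<Longrightarrow> a \<otimes> b = a \<oplus> lambda_map A a b"
  by (simp add: lambda_map_def a_simps)

lemma lambda_map_mult:
  assumes a: "a \<in> carrier A" and b: "b \<in> carrier A" and c: "c \<in> carrier A"
  shows "lambda_map A (a \<otimes> b) c = lambda_map A a (lambda_map A b c)"
proof -
  have "(a \<otimes> b) \<oplus> lambda_map A (a \<otimes> b) c = a \<otimes> (b \<otimes> c)"
    using a b c by (simp add: mult_eq_add_lambda_map[symmetric] m_assoc)
  also have "\<dots> = a \<oplus> lambda_map A a (b \<oplus> lambda_map A b c)"
    using a b c by (simp add: mult_eq_add_lambda_map lambda_map_closed a_closed)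
  also have "\<dots> = (a \<otimes> b) \<oplus> lambda_map A a (lambda_map A b c)"
    using a b c
    by (simp add: lambda_map_add lambda_map_closed a_simps mult_eq_add_lambda_map[of a b])
  finally show ?thesis
    using a b c by (metis a_neg_cancel(1) lambda_map_closed m_closed)
qed

lemma lambda_map_one: "c \<in> carrier A \<Longrightarrow> lambda_map A \<one> c = c"
  by (metis a_zero(1) l_one lambda_map_closed mult_eq_add_lambda_map one_closed zero_eq_one)

lemma lambda_map_auto:
  assumes a: "a \<in> carrier A" shows "lambda_map A a \<in> auto (add_monoid A)"
proof -
  have "bij_betw (lambda_map A a) (carrier A) (carrier A)"
  proof (rule bij_betw_byWitness[where f' = "lambda_map A (inv a)"])
    show "\<forall>b\<in>carrier A. lambda_map A (inv a) (lambda_map A a b) = b"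
      "\<forall>b\<in>carrier A. lambda_map A a (lambda_map A (inv a) b) = b"
      using a by (simp_all add: lambda_map_mult[symmetric] lambda_map_one)
  qed (use a in \<open>auto simp: lambda_map_closed\<close>)
  moreover have "lambda_map A a \<in> extensional (carrier A)"
    by (simp add: lambda_map_def)
  ultimately show ?thesis
    using a by (auto simp: auto_def Bij_def hom_def lambda_map_closed lambda_map_add)
qed

lemma lambda_map_hom: "lambda_map A \<in> hom A (AutoGroup (add_monoid A))"
proof (rule homI)
  fix a b assume ab: "a \<in> carrier A" "b \<in> carrier A"
  have "lambda_map A (a \<otimes> b) = compose (carrier A) (lambda_map A a) (lambda_map A b)"
  proof (rule extensionalityI)
    show "lambda_map A (a \<otimes> b) \<in> extensional (carrier A)"
      by (simp add: lambda_map_def)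
  qed (use ab in \<open>simp_all add: compose_def lambda_map_mult\<close>)
  then show "lambda_map A (a \<otimes> b) =
      lambda_map A a \<otimes>\<^bsub>AutoGroup (add_monoid A)\<^esub> lambda_map A b"
    using ab lambda_map_auto by (simp add: AutoGroup_def BijGroup_def auto_def)
qed (simp add: AutoGroup_def lambda_map_auto)

end

end

theory Submission
  imports Defs
begin

text \<open>
  The image \<open>L\<close> of \<open>\<lambda>\<close> and the group \<open>B\<close> of additive translations are subgroups of the symmetric
  group on \<open>A\<close>; \<open>L\<close> normalizes \<open>B\<close> and acts faithfully on it, and the left series becomes the series
  \<open>C\<^sub>0 = B\<close>, \<open>C\<^sub>j\<^sub>+\<^sub>1 = [C\<^sub>j, L]\<close>, which reaches the trivial group. Following P. Hall, \<open>L\<close> is nilpotent: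
  if a term of its lower central series centralizes \<open>C\<^sub>j\<^sub>+\<^sub>1\<close>, its action on \<open>C\<^sub>j\<close> is given by derivations
  whose values are pushed down the series by further commutators with \<open>L\<close>. Moreover
  \<open>C\<^sub>j\<^sub>+\<^sub>1 L\<close> is generated by the conjugates of its normal subgroup \<open>C\<^sub>j\<^sub>+\<^sub>2 L\<close> under \<open>C\<^sub>j\<close>, and these are
  again normal in it, so the Hirsch-Plotkin theorem shows, going up the series from \<open>L\<close>, that
  \<open>C\<^sub>1 L\<close>, and hence \<open>C\<^sub>1\<close>, is locally nilpotent.
\<close>

section \<open>Conjugation and commutators\<close>

context group
begin

definition conjugate :: "'a \<Rightarrow> 'a \<Rightarrow> 'a" where
  "conjugate g x = g \<otimes> x \<otimes> inv g"

definition comm :: "'a \<Rightarrow> 'a \<Rightarrow> 'a" where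
  "comm x y = x \<otimes> y \<otimes> inv x \<otimes> inv y"

text \<open>Only an inclusion is asked; for a subgroup \<open>H\<close> and \<open>K\<close> in the
  carrier it already forces \<open>K\<close> to equal its conjugates.\<close>

definition normalizes :: "'a set \<Rightarrow> 'a set \<Rightarrow> bool" where
  "normalizes H K \<longleftrightarrow> (\<forall>h\<in>H. \<forall>k\<in>K. conjugate h k \<in> K)"

lemma inv_cancel_left:
  assumes "x \<in> carrier G" "y \<in> carrier G"
  shows "inv x \<otimes> (x \<otimes> y) = y" "x \<otimes> (inv x \<otimes> y) = y"
  using assms by (simp_all add: m_assoc[symmetric])

lemmas group_word_simps = conjugate_def comm_def m_assoc inv_mult_group inv_cancel_left

lemma conj_closed [simp]: "\<lbrakk>g \<in> carrier G; x \<in> carrier G\<rbrakk> \<Longrightarrow> conjugate g x \<in> carrier G"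
  by (simp add: conjugate_def)

lemma comm_closed [simp]: "\<lbrakk>x \<in> carrier G; y \<in> carrier G\<rbrakk> \<Longrightarrow> comm x y \<in> carrier G"
  by (simp add: comm_def)

lemma conj_one [simp]: "g \<in> carrier G \<Longrightarrow> conjugate g \<one> = \<one>"
  by (simp add: conjugate_def)

lemma one_conj [simp]: "x \<in> carrier G \<Longrightarrow> conjugate \<one> x = x"
  by (simp add: conjugate_def)

lemma comm_one [simp]: "x \<in> carrier G \<Longrightarrow> comm x \<one> = \<one>" "x \<in> carrier G \<Longrightarrow> comm \<one> x = \<one>"
  by (simp_all add: comm_def)

lemma conj_mult:
  "\<lbrakk>g \<in> carrier G; x \<in> carrier G; y \<in> carrier G\<rbrakk> \<Longrightarrow> conjugate g (x \<otimes> y) = conjugate g x \<otimes> conjugate g y"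
  by (simp add: group_word_simps)

lemma conj_inv:
  "\<lbrakk>g \<in> carrier G; x \<in> carrier G\<rbrakk> \<Longrightarrow> conjugate g (inv x) = inv (conjugate g x)"
  by (simp add: group_word_simps)

lemma mult_conj:
  "\<lbrakk>g \<in> carrier G; h \<in> carrier G; x \<in> carrier G\<rbrakk> \<Longrightarrow> conjugate (g \<otimes> h) x = conjugate g (conjugate h x)"
  by (simp add: group_word_simps)

lemma conj_comm:
  "\<lbrakk>g \<in> carrier G; x \<in> carrier G; y \<in> carrier G\<rbrakk>
    \<Longrightarrow> conjugate g (comm x y) = comm (conjugate g x) (conjugate g y)"
  by (simp add: group_word_simps)

lemma inv_comm:
  "\<lbrakk>x \<in> carrier G; y \<in> carrier G\<rbrakk> \<Longrightarrow> inv (comm x y) = comm y x"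
  by (simp add: group_word_simps)

lemma comm_eq_mult_conj:
  "\<lbrakk>x \<in> carrier G; y \<in> carrier G\<rbrakk> \<Longrightarrow> comm x y = x \<otimes> conjugate y (inv x)"
  "\<lbrakk>x \<in> carrier G; y \<in> carrier G\<rbrakk> \<Longrightarrow> comm x y = conjugate x y \<otimes> inv y"
  by (simp_all add: group_word_simps)

lemma conj_eq_comm_mult:
  "\<lbrakk>x \<in> carrier G; y \<in> carrier G\<rbrakk> \<Longrightarrow> conjugate x y = comm x y \<otimes> y"
  by (simp add: group_word_simps)

lemma comm_mult_left:
  "\<lbrakk>x \<in> carrier G; y \<in> carrier G; z \<in> carrier G\<rbrakk>
    \<Longrightarrow> comm (x \<otimes> y) z = conjugate x (comm y z) \<otimes> comm x z"
  by (simp add: group_word_simps)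

lemma comm_mult_right:
  "\<lbrakk>x \<in> carrier G; y \<in> carrier G; z \<in> carrier G\<rbrakk>
    \<Longrightarrow> comm x (y \<otimes> z) = comm x y \<otimes> conjugate y (comm x z)"
  by (simp add: group_word_simps)

lemma comm_inv_left:
  "\<lbrakk>x \<in> carrier G; y \<in> carrier G\<rbrakk> \<Longrightarrow> comm (inv x) y = conjugate (inv x) (inv (comm x y))"
  by (simp add: group_word_simps)

lemma comm_inv_right:
  "\<lbrakk>x \<in> carrier G; y \<in> carrier G\<rbrakk> \<Longrightarrow> comm x (inv y) = conjugate (inv y) (inv (comm x y))"
  by (simp add: group_word_simps)

lemma normalizesD: "\<lbrakk>normalizes H K; h \<in> H; k \<in> K\<rbrakk> \<Longrightarrow> conjugate h k \<in> K"
  by (simp add: normalizes_def)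

lemma normalizes_mono: "\<lbrakk>normalizes H K; H' \<subseteq> H\<rbrakk> \<Longrightarrow> normalizes H' K"
  by (auto simp: normalizes_def)

lemma subgroup_normalizes_self: "subgroup H G \<Longrightarrow> normalizes H H"
  by (simp add: normalizes_def conjugate_def subgroup.m_closed subgroup.m_inv_closed)

lemma normalizes_Int: "\<lbrakk>normalizes H K; normalizes H K'\<rbrakk> \<Longrightarrow> normalizes H (K \<inter> K')"
  by (auto simp: normalizes_def)

section \<open>Generated subgroups: induction, normalization, finite supports\<close>

lemma generate_induct [consumes 2, case_names one incl mult inverse]:
  assumes "x \<in> generate G X" and "X \<subseteq> carrier G"
    and "P \<one>" and "\<And>x. x \<in> X \<Longrightarrow> P x"
    and "\<And>x y. \<lbrakk>x \<in> generate G X; y \<in> generate G X; P x; P y\<rbrakk> \<Longrightarrow> P (x \<otimes> y)"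
    and "\<And>x. \<lbrakk>x \<in> X; P x\<rbrakk> \<Longrightarrow> P (inv x)"
  shows "P x"
  using assms(1) by induction (auto intro: assms generate.intros)

lemma conj_generate:
  assumes X: "X \<subseteq> carrier G" and Y: "subgroup Y G" and g: "g \<in> carrier G"
    and XY: "\<And>x. x \<in> X \<Longrightarrow> conjugate g x \<in> Y" and x: "x \<in> generate G X"
  shows "conjugate g x \<in> Y"
  using x X
proof (induction rule: generate_induct)
  case (mult x y)
  then show ?case
    using generate_in_carrier[OF X] by (simp add: conj_mult g subgroup.m_closed[OF Y])
next
  case (inverse x)
  then have "conjugate g (inv x) = inv (conjugate g x)"
    using X g by (intro conj_inv) auto
  then show ?case
    using inverse subgroup.m_inv_closed[OF Y] by simp
qed (use XY g subgroup.one_closed[OF Y] in auto)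

lemma normalizes_generate:
  assumes "X \<subseteq> carrier G" "H \<subseteq> carrier G"
    and "\<And>h x. \<lbrakk>h \<in> H; x \<in> X\<rbrakk> \<Longrightarrow> conjugate h x \<in> generate G X"
  shows "normalizes H (generate G X)"
  unfolding normalizes_def
  using assms by (meson conj_generate generate_is_subgroup subsetD)

text \<open>\<open>normalizes\<close> is one-sided: conjugation by \<open>x\<close> may map an
  infinite \<open>K\<close> properly into itself. Hence the inverses of the generators get a
  hypothesis of their own.\<close>

lemma generate_normalizes:
  assumes X: "X \<subseteq> carrier G" and K: "K \<subseteq> carrier G"
    and n: "normalizes X K" and ni: "normalizes (m_inv G ` X) K"
  shows "normalizes (generate G X) K"
proof -
  have "\<forall>k\<in>K. conjugate g k \<in> K" if "g \<in> generate G X" for g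
    using that X
  proof (induction rule: generate_induct)
    case (mult x y)
    then show ?case
      using generate_in_carrier[OF X] K by (simp add: mult_conj subsetD)
  qed (use n ni K in \<open>auto simp: normalizes_def\<close>)
  then show ?thesis
    by (simp add: normalizes_def)
qed

text \<open>Each element is a word in finitely many generators, so a finite set uses only finitely
  many in all. Local statements are thereby reduced to finite generating sets.\<close>

lemma finite_subset_generate:
  assumes X: "X \<subseteq> carrier G" and S: "finite S" "S \<subseteq> generate G X"
  obtains T where "finite T" "T \<subseteq> X" "S \<subseteq> generate G T"
proof -
  have one: "\<exists>T. finite T \<and> T \<subseteq> X \<and> s \<in> generate G T" if "s \<in> generate G X" for s
    using that X
  proof (induction rule: generate_induct)
    case one
    then show ?case by (intro exI[of _ "{}"]) (auto intro: generate.one)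
  next
    case (incl x)
    then show ?case by (intro exI[of _ "{x}"]) (auto intro: generate.incl)
  next
    case (mult x y)
    then obtain T U where "finite T" "T \<subseteq> X" "x \<in> generate G T" "finite U" "U \<subseteq> X" "y \<in> generate G U"
      by blast
    then show ?case
      by (intro exI[of _ "T \<union> U"])
        (auto intro!: generate.eng intro: subsetD[OF mono_generate, rotated])
  next
    case (inverse x)
    then show ?case by (intro exI[of _ "{x}"]) (auto intro: generate.inv)
  qed
  then obtain f where f: "\<And>s. s \<in> generate G X \<Longrightarrow> finite (f s) \<and> f s \<subseteq> X \<and> s \<in> generate G (f s)"
    by metis
  show ?thesis
  proof
    show "finite (\<Union>(f ` S))" "\<Union>(f ` S) \<subseteq> X"
      using f S by auto
    show "S \<subseteq> generate G (\<Union>(f ` S))"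
    proof
      fix s assume "s \<in> S"
      then have "s \<in> generate G (f s)" "f s \<subseteq> \<Union>(f ` S)"
        using f S by auto
      then show "s \<in> generate G (\<Union>(f ` S))"
        using mono_generate by blast
    qed
  qed
qed

section \<open>Commutator subgroups\<close>

lemma commutator_subgroup_alt:
  "commutator_subgroup G H K = generate G {comm h k | h k. h \<in> H \<and> k \<in> K}"
  by (simp add: commutator_subgroup_def comm_def)

lemma commutators_closed:
  assumes "H \<subseteq> carrier G" "K \<subseteq> carrier G"
  shows "{comm h k | h k. h \<in> H \<and> k \<in> K} \<subseteq> carrier G"
  using assms by (blast intro: comm_closed)

lemma comm_in_commutator_subgroup:
  "\<lbrakk>h \<in> H; k \<in> K\<rbrakk> \<Longrightarrow> comm h k \<in> commutator_subgroup G H K"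
  unfolding commutator_subgroup_alt by (blast intro: generate.incl)

lemma commutator_subgroup_is_subgroup:
  "\<lbrakk>H \<subseteq> carrier G; K \<subseteq> carrier G\<rbrakk> \<Longrightarrow> subgroup (commutator_subgroup G H K) G"
  unfolding commutator_subgroup_alt by (intro generate_is_subgroup commutators_closed)

lemma commutator_subgroup_minimal:
  assumes "subgroup D G" "\<And>h k. \<lbrakk>h \<in> H; k \<in> K\<rbrakk> \<Longrightarrow> comm h k \<in> D"
  shows "commutator_subgroup G H K \<subseteq> D"
  unfolding commutator_subgroup_alt using assms by (intro generate_subgroup_incl) auto

lemma commutator_subgroup_mono:
  "\<lbrakk>H \<subseteq> H'; K \<subseteq> K'\<rbrakk> \<Longrightarrow> commutator_subgroup G H K \<subseteq> commutator_subgroup G H' K'"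
  unfolding commutator_subgroup_alt by (intro mono_generate) auto

lemma normalizes_commutator_subgroup:
  assumes "H \<subseteq> carrier G" "K \<subseteq> carrier G" "N \<subseteq> carrier G" "normalizes N H" "normalizes N K"
  shows "normalizes N (commutator_subgroup G H K)"
  unfolding commutator_subgroup_alt
proof (rule normalizes_generate)
  fix n x assume n: "n \<in> N" and "x \<in> {comm h k |h k. h \<in> H \<and> k \<in> K}"
  then obtain h k where x: "x = comm h k" "h \<in> H" "k \<in> K"
    by blast
  then have "conjugate n x = comm (conjugate n h) (conjugate n k)"
    using assms n by (auto intro!: conj_comm)
  moreover have "conjugate n h \<in> H" "conjugate n k \<in> K"
    using x n assms by (auto dest: normalizesD)
  ultimately show "conjugate n x \<in> generate G {comm h k |h k. h \<in> H \<and> k \<in> K}"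
    by (blast intro: generate.incl)
qed (use assms commutators_closed in simp_all)

text \<open>Since \<open>[n h, k] = n [h, k] n^-1 [n, k]\<close>, a conjugate of a generator is a
  generator times the inverse of another.\<close>

lemma left_normalizes_commutator_subgroup:
  assumes H: "subgroup H G" and K: "K \<subseteq> carrier G"
  shows "normalizes H (commutator_subgroup G H K)"
  unfolding commutator_subgroup_alt
proof (rule normalizes_generate)
  let ?X = "{comm h k |h k. h \<in> H \<and> k \<in> K}"
  have Hc: "H \<subseteq> carrier G" by (rule subgroup.subset[OF H])
  show "?X \<subseteq> carrier G" "H \<subseteq> carrier G"
    using Hc K commutators_closed by simp_all
  fix n x assume n: "n \<in> H" and "x \<in> ?X"
  then obtain h k where x: "x = comm h k" "h \<in> H" "k \<in> K"
    by blast
  have cl: "n \<in> carrier G" "h \<in> carrier G" "k \<in> carrier G"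
    using n x Hc K by auto
  have "conjugate n x = comm (n \<otimes> h) k \<otimes> inv (comm n k)"
    using cl by (simp add: x comm_mult_left m_assoc)
  moreover have "comm (n \<otimes> h) k \<in> ?X" "comm n k \<in> ?X"
    using n x subgroup.m_closed[OF H] by blast+
  ultimately show "conjugate n x \<in> generate G ?X"
    by (simp add: generate.eng generate.incl generate.inv)
qed

text \<open>The product and inverse rules express a commutator of words through conjugates of
  commutators of generators, and \<open>D\<close> absorbs these conjugates.\<close>

lemma comm_generate_in:
  assumes X: "X \<subseteq> carrier G" and S: "S \<subseteq> carrier G" and D: "subgroup D G"
    and nX: "normalizes (generate G X) D" and nS: "normalizes (generate G S) D"
    and XS: "\<And>x s. \<lbrakk>x \<in> X; s \<in> S\<rbrakk> \<Longrightarrow> comm x s \<in> D"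
    and xg: "x \<in> generate G X" "g \<in> generate G S"
  shows "comm x g \<in> D"
proof -
  note [simp] = generate_in_carrier[OF X] generate_in_carrier[OF S]
    subgroup.m_closed[OF D] subgroup.m_inv_closed[OF D] subgroup.one_closed[OF D]
  \<comment> \<open>The second argument is extended to words first, with the first one a generator;
    the induction on the first argument follows.\<close>
  have 1: "comm x g \<in> D" if x: "x \<in> X" and g: "g \<in> generate G S" for x g
  proof -
    have xc: "x \<in> carrier G" using x X by auto
    show ?thesis
      using g S
    proof (induction rule: generate_induct)
      case (mult y z)
      then show ?case using xc normalizesD[OF nS] by (simp add: comm_mult_right)
    next
      case (inverse y)
      then have "inv y \<in> generate G S" "y \<in> carrier G"
        using S by (auto intro: generate.inv)
      then show ?case using xc inverse normalizesD[OF nS] by (simp add: comm_inv_right)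
    qed (use xc x XS in auto)
  qed
  show ?thesis
    using xg(1) X
  proof (induction rule: generate_induct)
    case (mult y z)
    then show ?case using xg(2) normalizesD[OF nX] by (simp add: comm_mult_left)
  next
    case (inverse y)
    then have "inv y \<in> generate G X" "y \<in> carrier G"
      using X by (auto intro: generate.inv)
    then show ?case using xg(2) inverse normalizesD[OF nX] by (simp add: comm_inv_left)
  qed (use 1 xg(2) in auto)
qed

end


section \<open>Nilpotent and locally nilpotent subgroups\<close>

context group
begin

text \<open>The lower central series taken inside the ambient group, so that subgroups can be
  compared without changing the group record.\<close>

primrec lcs :: "'a set \<Rightarrow> nat \<Rightarrow> 'a set" where
  "lcs H 0 = H"
| "lcs H (Suc n) = commutator_subgroup G (lcs H n) H"

definition nilpotent_in :: "'a set \<Rightarrow> bool" where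
  "nilpotent_in H \<longleftrightarrow> (\<exists>n. lcs H n \<subseteq> {\<one>})"

definition locally_nilpotent_in :: "'a set \<Rightarrow> bool" where
  "locally_nilpotent_in H \<longleftrightarrow> (\<forall>S. finite S \<and> S \<subseteq> H \<longrightarrow> nilpotent_in (generate G S))"

lemma lcs_subgroup: "subgroup H G \<Longrightarrow> subgroup (lcs H n) G"
  by (induction n) (auto intro: commutator_subgroup_is_subgroup dest: subgroup.subset)

lemma lcs_mono: "H \<subseteq> K \<Longrightarrow> lcs H n \<subseteq> lcs K n"
  by (induction n) (simp_all add: commutator_subgroup_mono)

lemma normalizes_lcs:
  "\<lbrakk>subgroup H G; N \<subseteq> carrier G; normalizes N H\<rbrakk> \<Longrightarrow> normalizes N (lcs H n)"
  by (induction n) (simp_all add: normalizes_commutator_subgroup lcs_subgroup subgroup.subset)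

lemma comm_in_of_normalizes:
  assumes "subgroup K G" "H \<subseteq> carrier G" "normalizes H K" "k \<in> K" "h \<in> H"
  shows "comm k h \<in> K" "comm h k \<in> K"
proof -
  have c: "k \<in> carrier G" "h \<in> carrier G"
    using assms subgroup.subset by auto
  show "comm k h \<in> K" "comm h k \<in> K"
    using assms c
    by (simp_all add: comm_eq_mult_conj(1)[of k h] comm_eq_mult_conj(2)[of h k] normalizesD
        subgroup.m_closed subgroup.m_inv_closed)
qed

lemma lcs_Suc_subset:
  assumes "subgroup H G" shows "lcs H (Suc n) \<subseteq> lcs H n"
proof -
  have "normalizes H (lcs H n)"
    by (rule normalizes_lcs[OF assms subgroup.subset[OF assms] subgroup_normalizes_self[OF assms]])
  then show ?thesis
    unfolding lcs.simps using lcs_subgroup[OF assms] subgroup.subset[OF assms]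
    by (intro commutator_subgroup_minimal comm_in_of_normalizes(1)[of _ H])
qed

lemma lcs_antimono: "\<lbrakk>subgroup H G; m \<le> n\<rbrakk> \<Longrightarrow> lcs H n \<subseteq> lcs H m"
  using lift_Suc_antimono_le[of "lcs H"] lcs_Suc_subset by blast

lemma nilpotent_in_mono: "\<lbrakk>nilpotent_in K; H \<subseteq> K\<rbrakk> \<Longrightarrow> nilpotent_in H"
  unfolding nilpotent_in_def using lcs_mono by blast

text \<open>By induction the lower central series descends at least as fast as the central series
  \<open>D\<close>. This is the nilpotency criterion used below.\<close>

lemma nilpotent_in_central_series:
  assumes "\<And>n. subgroup (D n) G" "J \<subseteq> D 0"
    and "\<And>n d g. \<lbrakk>d \<in> D n; g \<in> J\<rbrakk> \<Longrightarrow> comm d g \<in> D (Suc n)" "D m \<subseteq> {\<one>}"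
  shows "nilpotent_in J"
proof -
  have "lcs J n \<subseteq> D n" for n
  proof (induction n)
    case (Suc n)
    then show ?case
      unfolding lcs.simps using assms(1,3) by (intro commutator_subgroup_minimal) auto
  qed (use assms(2) in simp)
  then show ?thesis
    unfolding nilpotent_in_def using assms(4) by blast
qed

lemma locally_nilpotent_in_mono:
  "\<lbrakk>locally_nilpotent_in K; H \<subseteq> K\<rbrakk> \<Longrightarrow> locally_nilpotent_in H"
  unfolding locally_nilpotent_in_def by blast

lemma nilpotent_imp_locally_nilpotent_in:
  "\<lbrakk>subgroup H G; nilpotent_in H\<rbrakk> \<Longrightarrow> locally_nilpotent_in H"
  unfolding locally_nilpotent_in_def
  using nilpotent_in_mono generate_subgroup_incl by blast

text \<open>Conjugation by \<open>x\<close> is an automorphism: the conjugated lower central series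
  of a finitely generated preimage is a central series that ends in the trivial group.\<close>

lemma locally_nilpotent_in_conj:
  assumes x: "x \<in> carrier G" and H: "H \<subseteq> carrier G" and ln: "locally_nilpotent_in H"
  shows "locally_nilpotent_in (conjugate x ` H)"
  unfolding locally_nilpotent_in_def
proof (intro allI impI)
  fix S assume S: "finite S \<and> S \<subseteq> conjugate x ` H"
  then obtain T where T: "T \<subseteq> H" "finite T" "S = conjugate x ` T"
    by (meson finite_subset_image)
  then have Tc: "T \<subseteq> carrier G" and Sc: "S \<subseteq> carrier G"
    using H x by auto
  define N where "N = generate G T"
  have N: "subgroup N G"
    unfolding N_def using Tc by (rule generate_is_subgroup)
  obtain n where n: "lcs N n \<subseteq> {\<one>}"
    using ln T unfolding locally_nilpotent_in_def nilpotent_in_def N_def by blast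
  let ?D = "\<lambda>n. conjugate x ` lcs N n"
  have sub: "subgroup (?D k) G" for k
  proof -
    interpret group_hom G G "conjugate x"
      using x by unfold_locales (auto simp: hom_def conj_mult)
    show ?thesis
      using subgroup_img_is_subgroup[OF lcs_subgroup[OF N]] by simp
  qed
  have "generate G S \<subseteq> conjugate x ` N"
    using T generate_subgroup_incl[of S "?D 0"] sub[of 0] generate.incl[of _ T G] by (auto simp: N_def)
  moreover have "comm d g \<in> ?D (Suc k)" if d: "d \<in> ?D k" and g: "g \<in> conjugate x ` N" for k d g
  proof -
    obtain d' g' where "d = conjugate x d'" "d' \<in> lcs N k" "g = conjugate x g'" "g' \<in> N"
      using d g by blast
    moreover have "comm (conjugate x d') (conjugate x g') = conjugate x (comm d' g')"
      using calculation x subgroup.subset[OF N] subgroup.subset[OF lcs_subgroup[OF N]]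
      by (intro conj_comm[symmetric]) auto
    ultimately show ?thesis
      by (auto intro!: imageI comm_in_commutator_subgroup)
  qed
  moreover have "?D n \<subseteq> {\<one>}"
    using n x by auto
  ultimately show "nilpotent_in (generate G S)"
    using sub by (intro nilpotent_in_central_series[of ?D _ n]) auto
qed

text \<open>Fitting's theorem. The intersections of the \<open>i\<close>-th term for
  \<open>H\<close> with the \<open>(n - i)\<close>-th term for \<open>K\<close> generate a central
  series of \<open>J\<close>: a commutator with an element of \<open>H\<close> raises the first
  index, one with an element of \<open>K\<close> the second.\<close>

lemma fitting:
  assumes H: "subgroup H G" and K: "subgroup K G" and nHK: "normalizes H K" and nKH: "normalizes K H"
    and nilH: "nilpotent_in H" and nilK: "nilpotent_in K"
  shows "nilpotent_in (generate G (H \<union> K))"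
proof -
  define J where "J = generate G (H \<union> K)"
  have HKc: "H \<union> K \<subseteq> carrier G"
    using H K subgroup.subset by auto
  have J: "subgroup J G"
    unfolding J_def by (rule generate_is_subgroup[OF HKc])
  have Jc: "J \<subseteq> carrier G"
    by (rule subgroup.subset[OF J])
  have HJ: "H \<subseteq> J" and KJ: "K \<subseteq> J"
    unfolding J_def by (auto intro: generate.incl)
  have JN: "normalizes J N" if "N \<subseteq> carrier G" "normalizes H N" "normalizes K N" for N
    unfolding J_def
  proof (rule generate_normalizes)
    show "normalizes (m_inv G ` (H \<union> K)) N"
      using that subgroup.m_inv_closed[OF H] subgroup.m_inv_closed[OF K]
      by (auto simp: normalizes_def)
  qed (use that HKc in \<open>auto simp: normalizes_def\<close>)
  have J_H: "normalizes J H" and J_K: "normalizes J K"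
    using JN[of H] JN[of K] nHK nKH HKc subgroup_normalizes_self[OF H] subgroup_normalizes_self[OF K]
    by simp_all
  \<comment> \<open>The lower central series of a normal subgroup, extended by the whole group \<open>J\<close>.\<close>
  define g where "g N i = (case i of 0 \<Rightarrow> J | Suc i \<Rightarrow> lcs N i)" for N i
  have g_sub: "subgroup (g N i) G" if "subgroup N G" for N i
    using that J by (auto simp: g_def lcs_subgroup split: nat.split)
  have g_norm: "normalizes J (g N i)" if "subgroup N G" "normalizes J N" for N i
    using normalizes_lcs[OF that(1) Jc that(2)] subgroup_normalizes_self[OF J]
    by (simp add: g_def split: nat.split)
  have g_comm: "comm x h \<in> g N (Suc i)"
    if "subgroup N G" "normalizes J N" "x \<in> g N i" "h \<in> N" for N i x h
    using that comm_in_of_normalizes(2)[OF that(1) Jc that(2), of h x]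
    by (cases i) (simp_all add: g_def comm_in_commutator_subgroup)
  define X where "X n = (\<Union>i\<le>n. g H i \<inter> g K (n - i))" for n
  have Xc: "X n \<subseteq> carrier G" for n
    unfolding X_def using subgroup.subset[OF g_sub[OF H]] by blast
  define D where "D n = generate G (X n)" for n
  have D: "subgroup (D n) G" for n
    unfolding D_def by (rule generate_is_subgroup[OF Xc])
  have JX: "normalizes J (X n)" for n
    unfolding normalizes_def
  proof (intro ballI)
    fix h k assume h: "h \<in> J" and "k \<in> X n"
    then obtain i where "i \<le> n" "k \<in> g H i" "k \<in> g K (n - i)"
      by (auto simp: X_def)
    then show "conjugate h k \<in> X n"
      using normalizesD[OF g_norm[OF H J_H] h] normalizesD[OF g_norm[OF K J_K] h]
      unfolding X_def by (intro UN_I[of i]) simp_all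
  qed
  have JD: "normalizes J (D n)" for n
    unfolding D_def
    by (rule normalizes_generate[OF Xc Jc]) (rule generate.incl[OF normalizesD[OF JX]])
  have J0: "J \<subseteq> D 0"
    by (auto simp: D_def X_def g_def intro: generate.incl)
  have gJ: "g H i \<subseteq> J" for i
    using HJ lcs_antimono[OF H, of 0] by (auto simp: g_def split: nat.split)
  have XJ: "X n \<subseteq> J" for n
    using gJ by (auto simp: X_def)
  have DJ: "D n \<subseteq> J" for n
    unfolding D_def by (rule generate_subgroup_incl[OF XJ J])
  have key: "comm x s \<in> X (Suc n)" if x: "x \<in> X n" and s: "s \<in> H \<union> K" for x s n
  proof -
    obtain i where i: "i \<le> n" "x \<in> g H i" "x \<in> g K (n - i)"
      using x by (auto simp: X_def)
    have "s \<in> J" using s HJ KJ by auto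
    show ?thesis
    proof (cases "s \<in> H")
      case True
      then have "comm x s \<in> g H (Suc i)" "comm x s \<in> g K (n - i)"
        using i Jc \<open>s \<in> J\<close> g_comm[OF H J_H] comm_in_of_normalizes[OF g_sub[OF K] Jc g_norm[OF K J_K]]
        by auto
      then show ?thesis
        using i by (auto simp: X_def intro!: bexI[of _ "Suc i"])
    next
      case False
      then have "s \<in> K" using s by auto
      then have "comm x s \<in> g H i" "comm x s \<in> g K (Suc (n - i))"
        using i Jc \<open>s \<in> J\<close> g_comm[OF K J_K] comm_in_of_normalizes[OF g_sub[OF H] Jc g_norm[OF H J_H]]
        by auto
      then show ?thesis
        using i by (auto simp: X_def Suc_diff_le intro!: bexI[of _ i])
    qed
  qed
  have step: "comm d h \<in> D (Suc n)" if "d \<in> D n" "h \<in> J" for d h n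
  proof (rule comm_generate_in[OF Xc HKc D])
    show "normalizes (generate G (X n)) (D (Suc n))"
      using JD DJ normalizes_mono unfolding D_def by blast
    show "normalizes (generate G (H \<union> K)) (D (Suc n))"
      using JD unfolding J_def by blast
    show "comm x s \<in> D (Suc n)" if "x \<in> X n" "s \<in> H \<union> K" for x s
      using key[OF that] unfolding D_def by (rule generate.incl)
  qed (use that in \<open>simp_all add: D_def J_def\<close>)
  obtain a b where ab: "lcs H a \<subseteq> {\<one>}" "lcs K b \<subseteq> {\<one>}"
    using nilH nilK unfolding nilpotent_in_def by blast
  \<comment> \<open>With total weight \<open>a + b + 1\<close>, either the index \<open>i\<close>
    for \<open>H\<close> exceeds \<open>a\<close> or the remaining index for \<open>K\<close>
    exceeds \<open>b\<close>; as \<open>g\<close> is shifted by one, that term is trivial.\<close>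
  have "X (Suc (a + b)) \<subseteq> {\<one>}"
  proof
    fix x assume "x \<in> X (Suc (a + b))"
    then obtain i where i: "i \<le> Suc (a + b)" "x \<in> g H i" "x \<in> g K (Suc (a + b) - i)"
      by (auto simp: X_def)
    show "x \<in> {\<one>}"
    proof (cases "i \<le> a")
      case True
      then have "Suc (a + b) - i = Suc (a + b - i)" "b \<le> a + b - i"
        by auto
      then have "x \<in> lcs K b"
        using i(3) lcs_antimono[OF K, of b "a + b - i"] by (auto simp: g_def)
      then show ?thesis using ab by auto
    next
      case False
      then obtain k where "i = Suc k" "a \<le> k"
        by (cases i) auto
      then have "x \<in> lcs H a"
        using i(2) lcs_antimono[OF H, of a k] by (auto simp: g_def)
      then show ?thesis using ab by auto
    qed
  qed
  then have "D (Suc (a + b)) \<subseteq> {\<one>}"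
    unfolding D_def using generate_subgroup_incl triv_subgroup by blast
  then show ?thesis
    using nilpotent_in_central_series[OF D J0 step] unfolding J_def by blast
qed

text \<open>In a finitely generated nilpotent group, a normal closure of finitely many elements is
  generated by iterated commutators with the generators, hence finitely generated.\<close>

lemma finite_normal_closure:
  assumes Q: "finite Q" "Q \<subseteq> carrier G" and D: "finite D" "D \<subseteq> R" and R: "subgroup R G"
    and QR: "normalizes Q R" and nil: "nilpotent_in (generate G (Q \<union> D))"
  obtains T where "finite T" "D \<subseteq> T" "T \<subseteq> R" "normalizes Q (generate G T)"
proof -
  let ?N = "generate G (Q \<union> D)"
  obtain n where n: "lcs ?N n \<subseteq> {\<one>}"
    using nil unfolding nilpotent_in_def by blast
  \<comment> \<open>\<open>E k\<close> consists of the left-normed commutators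
    \<open>[d, q1, ..., qk]\<close> with \<open>d\<close> in \<open>D\<close> and all
    \<open>qi\<close> in \<open>Q\<close>.\<close>
  define E where "E = rec_nat D (\<lambda>_ X. (\<lambda>(d, q). comm d q) ` (X \<times> Q))"
  have E_0: "E 0 = D" and E_Suc: "E (Suc k) = (\<lambda>(d, q). comm d q) ` (E k \<times> Q)" for k
    by (simp_all add: E_def)
  have Rc: "R \<subseteq> carrier G"
    by (rule subgroup.subset[OF R])
  have fin: "finite (E k)" for k
    by (induction k) (use Q D in \<open>simp_all add: E_0 E_Suc\<close>)
  have ER: "E k \<subseteq> R" for k
  proof (induction k)
    case (Suc k)
    then show ?case
      using comm_in_of_normalizes(1)[OF R Q(2) QR] by (auto simp: E_Suc)
  qed (use D in \<open>simp add: E_0\<close>)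
  have E_lcs: "E k \<subseteq> lcs ?N k" for k
  proof (induction k)
    case 0
    then show ?case by (auto simp: E_0 intro: generate.incl)
  next
    case (Suc k)
    then show ?case
      by (auto simp: E_Suc intro!: comm_in_commutator_subgroup intro: generate.incl)
  qed
  \<comment> \<open>Layers up to \<open>n\<close> suffice: a commutator with an element of
    \<open>Q\<close> leads from one layer to the next, and \<open>E n\<close> lies in the trivial
    term \<open>lcs ?N n\<close>.\<close>
  define T where "T = (\<Union>k\<le>n. E k)"
  have T: "finite T" "T \<subseteq> R" "D \<subseteq> T"
    using fin ER E_0 by (auto simp: T_def)
  then have Tc: "T \<subseteq> carrier G"
    using Rc by auto
  have comm_T: "comm t q \<in> generate G T" if tq: "t \<in> T" "q \<in> Q" for t q
  proof -
    obtain k where k: "k \<le> n" "t \<in> E k"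
      using tq(1) by (auto simp: T_def)
    show ?thesis
    proof (cases "k = n")
      case True
      then have "t = \<one>"
        using k E_lcs n by blast
      then show ?thesis
        using tq(2) Q(2) by (simp add: subsetD generate.one)
    next
      case False
      then have "Suc k \<le> n" "comm t q \<in> E (Suc k)"
        using k tq(2) by (auto simp: E_Suc)
      then show ?thesis
        by (auto simp: T_def intro: generate.incl)
    qed
  qed
  have "conjugate q t \<in> generate G T" if tq: "t \<in> T" "q \<in> Q" for t q
  proof -
    have c: "t \<in> carrier G" "q \<in> carrier G"
      using tq Tc Q by auto
    then have "conjugate q t = inv (comm t q) \<otimes> t"
      by (simp add: inv_comm conj_eq_comm_mult)
    then show ?thesis
      using comm_T[OF tq] tq(1) generate_m_inv_closed[OF Tc] by (simp add: generate.eng generate.incl)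
  qed
  then have "normalizes Q (generate G T)"
    using Tc Q(2) by (intro normalizes_generate) 
  then show thesis
    using T that by blast
qed

text \<open>The commutators \<open>[p, q]\<close> lie in \<open>M\<close> and in \<open>N\<close>.
  Local nilpotence of \<open>N\<close> puts them into a finitely generated
  \<open>Q\<close>-invariant subgroup of the intersection, and that of \<open>M\<close> makes its
  join with \<open>P\<close> nilpotent. As \<open>P\<close> and \<open>Q\<close> are closed under
  inverses, normalization can be tested on them.\<close>

lemma finite_generated_nilpotent_normal_closure:
  assumes M: "subgroup M G" and N: "subgroup N G"
    and MN: "normalizes M N" and NM: "normalizes N M"
    and lnM: "locally_nilpotent_in M" and lnN: "locally_nilpotent_in N"
    and P: "finite P" "P \<subseteq> M" "m_inv G ` P \<subseteq> P" and Q: "finite Q" "Q \<subseteq> N" "m_inv G ` Q \<subseteq> Q"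
  obtains H where "subgroup H G" "P \<subseteq> H" "H \<subseteq> generate G (P \<union> Q)" "normalizes (generate G (P \<union> Q)) H"
    "nilpotent_in H"
proof -
  define J where "J = generate G (P \<union> Q)"
  have Mc: "M \<subseteq> carrier G" and Nc: "N \<subseteq> carrier G"
    using M N subgroup.subset by auto
  then have PQc: "P \<union> Q \<subseteq> carrier G"
    using P Q by auto
  have J: "subgroup J G"
    unfolding J_def by (rule generate_is_subgroup[OF PQc])
  have PJ: "P \<subseteq> J" and QJ: "Q \<subseteq> J"
    unfolding J_def by (auto intro: generate.incl)
  define D where "D = (\<lambda>(p, q). comm p q) ` (P \<times> Q)"
  define R where "R = M \<inter> N \<inter> J"
  have R: "subgroup R G"
    unfolding R_def by (intro subgroups_Inter_pair M N J)
  have commR: "comm p q \<in> R" if "p \<in> P" "q \<in> Q" for p q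
  proof -
    have "p \<in> M" "q \<in> N" "p \<in> J" "q \<in> J"
      using that P Q PJ QJ by auto
    then show ?thesis
      unfolding R_def
      using comm_in_of_normalizes(1)[OF M Nc NM] comm_in_of_normalizes(2)[OF N Mc MN]
        comm_in_of_normalizes(1)[OF J subgroup.subset[OF J] subgroup_normalizes_self[OF J]]
      by blast
  qed
  have D: "finite D" "D \<subseteq> R"
    using P Q commR by (auto simp: D_def)
  have "normalizes Q R"
    unfolding R_def
    using normalizes_mono[OF NM Q(2)] normalizes_mono[OF subgroup_normalizes_self[OF N] Q(2)]
      normalizes_mono[OF subgroup_normalizes_self[OF J] QJ]
    by (intro normalizes_Int)
  moreover have "nilpotent_in (generate G (Q \<union> D))"
    using lnN Q D unfolding locally_nilpotent_in_def R_def by simp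
  moreover have "Q \<subseteq> carrier G"
    using PQc by simp
  ultimately obtain T where T: "finite T" "D \<subseteq> T" "T \<subseteq> R" "normalizes Q (generate G T)"
    using finite_normal_closure Q(1) D R by metis
  define H where "H = generate G (P \<union> T)"
  have PTc: "P \<union> T \<subseteq> carrier G"
    using PQc T(3) subgroup.subset[OF R] by auto
  have H: "subgroup H G"
    unfolding H_def by (rule generate_is_subgroup[OF PTc])
  have PH: "P \<subseteq> H" and TH: "generate G T \<subseteq> H"
    unfolding H_def by (auto intro: generate.incl mono_generate[THEN subsetD, rotated])
  have QH: "normalizes Q H"
    unfolding H_def
  proof (rule normalizes_generate[OF PTc])
    fix q x assume q: "q \<in> Q" and x: "x \<in> P \<union> T"
    then have c: "q \<in> carrier G" "x \<in> carrier G"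
      using PQc PTc by auto
    \<comment> \<open>For \<open>x\<close> in \<open>P\<close> the conjugate is
      \<open>[x, q]^-1 x\<close>, and \<open>[x, q]\<close> belongs to \<open>D\<close>, hence to
      \<open>T\<close>.\<close>
    have "conjugate q x \<in> H"
    proof (cases "x \<in> T")
      case True
      then show ?thesis
        using normalizesD[OF T(4) q] TH by (blast intro: generate.incl)
    next
      case False
      then have "x \<in> P" using x by simp
      then have "comm x q \<in> H" "x \<in> H"
        using q T(2) TH PH by (auto simp: D_def intro: generate.incl)
      moreover have "conjugate q x = inv (comm x q) \<otimes> x"
        using c by (simp add: inv_comm conj_eq_comm_mult)
      ultimately show ?thesis
        using H by (simp add: subgroup.m_closed subgroup.m_inv_closed)
    qed
    then show "conjugate q x \<in> generate G (P \<union> T)"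
      by (simp add: H_def)
  qed (use PQc in simp)
  have PQH: "normalizes (P \<union> Q) H"
    using normalizes_mono[OF subgroup_normalizes_self[OF H] PH] QH by (auto simp: normalizes_def)
  show thesis
  proof
    show "normalizes (generate G (P \<union> Q)) H"
    proof (rule generate_normalizes[OF PQc subgroup.subset[OF H] PQH])
      show "normalizes (m_inv G ` (P \<union> Q)) H"
        using P Q by (intro normalizes_mono[OF PQH]) auto
    qed
    show "H \<subseteq> generate G (P \<union> Q)"
      using J PJ T(3) unfolding H_def R_def J_def[symmetric] by (intro generate_subgroup_incl) auto
    show "nilpotent_in H"
      using lnM P T unfolding H_def locally_nilpotent_in_def R_def by simp
  qed (fact H PH)+
qed

text \<open>Finitely many elements involve only finite sets \<open>P\<close> in \<open>M\<close> and
  \<open>Q\<close> in \<open>N\<close>. In the group generated by these, the preceding lemma yields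
  nilpotent normal subgroups around \<open>P\<close> and around \<open>Q\<close>, and Fitting's
  theorem joins them.\<close>

lemma hirsch_plotkin:
  assumes M: "subgroup M G" and N: "subgroup N G"
    and MN: "normalizes M N" and NM: "normalizes N M"
    and lnM: "locally_nilpotent_in M" and lnN: "locally_nilpotent_in N"
  shows "locally_nilpotent_in (generate G (M \<union> N))"
  unfolding locally_nilpotent_in_def
proof (intro allI impI)
  fix S assume S: "finite S \<and> S \<subseteq> generate G (M \<union> N)"
  have Mc: "M \<subseteq> carrier G" and Nc: "N \<subseteq> carrier G"
    using M N subgroup.subset by auto
  obtain T where T: "finite T" "T \<subseteq> M \<union> N" "S \<subseteq> generate G T"
    using finite_subset_generate[of "M \<union> N" S] Mc Nc S by auto
  \<comment> \<open>Adding the inverses keeps the parts of \<open>T\<close> finite and makes them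
    symmetric, as the preceding lemma requires.\<close>
  have sym: "\<exists>P. finite P \<and> P \<subseteq> L \<and> m_inv G ` P \<subseteq> P \<and> T \<inter> L \<subseteq> P" if L: "subgroup L G" for L
  proof (intro exI conjI)
    show "m_inv G ` (T \<inter> L \<union> m_inv G ` (T \<inter> L)) \<subseteq> T \<inter> L \<union> m_inv G ` (T \<inter> L)"
      using subgroup.subset[OF L] by (auto simp: subset_iff)
  qed (use T(1) subgroup.m_inv_closed[OF L] in auto)
  obtain P where P: "finite P" "P \<subseteq> M" "m_inv G ` P \<subseteq> P" "T \<inter> M \<subseteq> P"
    using sym[OF M] by blast
  obtain Q where Q: "finite Q" "Q \<subseteq> N" "m_inv G ` Q \<subseteq> Q" "T \<inter> N \<subseteq> Q"
    using sym[OF N] by blast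
  let ?J = "generate G (P \<union> Q)"
  obtain H where H: "subgroup H G" "P \<subseteq> H" "H \<subseteq> ?J" "normalizes ?J H" "nilpotent_in H"
    using finite_generated_nilpotent_normal_closure[OF M N MN NM lnM lnN P(1-3) Q(1-3)] by blast
  obtain K where K: "subgroup K G" "Q \<subseteq> K" "K \<subseteq> ?J" "normalizes ?J K" "nilpotent_in K"
    using finite_generated_nilpotent_normal_closure[OF N M NM MN lnN lnM Q(1-3) P(1-3)]
    by (metis Un_commute)
  have nil: "nilpotent_in (generate G (H \<union> K))"
    using H K normalizes_mono by (intro fitting) blast+
  have "H \<union> K \<subseteq> carrier G"
    using H(1) K(1) subgroup.subset by auto
  moreover have "T \<subseteq> H \<union> K"
    using T(2) P(4) Q(4) H(2) K(2) by blast
  ultimately have "S \<subseteq> generate G (H \<union> K)"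
    using T(3) mono_generate[of T "H \<union> K"] by auto
  then have "generate G S \<subseteq> generate G (H \<union> K)"
    using \<open>H \<union> K \<subseteq> carrier G\<close> by (intro generate_subgroup_incl generate_is_subgroup)
  then show "nilpotent_in (generate G S)"
    using nil nilpotent_in_mono by blast
qed

text \<open>Normalization by \<open>K\<close> is carried through the induction, since the theorem
  for two subgroups needs them to normalize each other.\<close>

lemma hirsch_plotkin_finite_Union:
  assumes "finite \<F>" and K: "K \<subseteq> carrier G"
    and "\<And>M. M \<in> \<F> \<Longrightarrow> subgroup M G \<and> M \<subseteq> K \<and> normalizes K M \<and> locally_nilpotent_in M"
  shows "locally_nilpotent_in (generate G (\<Union>\<F>)) \<and> normalizes K (generate G (\<Union>\<F>))"
  using assms(1,3)
proof (induction rule: finite_induct)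
  case empty
  have "subgroup {\<one>} G" "nilpotent_in {\<one>}"
    by (auto simp: triv_subgroup nilpotent_in_def intro: exI[of _ 0])
  then have "locally_nilpotent_in {\<one>}"
    by (rule nilpotent_imp_locally_nilpotent_in)
  then show ?case
    using K by (auto simp: generate_empty normalizes_def)
next
  case (insert M \<F>)
  let ?N = "generate G (\<Union>\<F>)"
  have M: "subgroup M G" "M \<subseteq> K" "normalizes K M" "locally_nilpotent_in M"
    using insert.prems by auto
  have IH: "locally_nilpotent_in ?N" "normalizes K ?N"
    using insert by auto
  have FK: "\<Union>\<F> \<subseteq> K"
    using insert.prems by blast
  have Fc: "\<Union>\<F> \<subseteq> carrier G"
    using FK K by blast
  have N: "subgroup ?N G"
    by (rule generate_is_subgroup[OF Fc])
  have KM: "normalizes (m_inv G ` \<Union>\<F>) M"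
  proof (rule normalizes_mono[OF M(3)])
    show "m_inv G ` \<Union>\<F> \<subseteq> K"
      using insert.prems subgroup.m_inv_closed by fastforce
  qed
  have "normalizes ?N M"
    using generate_normalizes[OF Fc subgroup.subset[OF M(1)] normalizes_mono[OF M(3) FK] KM] .
  then have ln: "locally_nilpotent_in (generate G (M \<union> ?N))"
    using hirsch_plotkin[OF M(1) N normalizes_mono[OF IH(2) M(2)]] M IH by blast
  have MFc: "\<Union>(insert M \<F>) \<subseteq> carrier G"
    using M(2) FK K by auto
  have "generate G (\<Union>(insert M \<F>)) \<subseteq> generate G (M \<union> ?N)"
    by (rule mono_generate) (auto intro: generate.incl)
  then have "locally_nilpotent_in (generate G (\<Union>(insert M \<F>)))"
    using ln locally_nilpotent_in_mono by blast
  moreover have "normalizes K (generate G (\<Union>(insert M \<F>)))"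
  proof (rule normalizes_generate[OF MFc K])
    fix k x assume "k \<in> K" "x \<in> \<Union>(insert M \<F>)"
    then have "conjugate k x \<in> \<Union>(insert M \<F>)"
      using insert.prems normalizesD by (metis UnionE UnionI)
    then show "conjugate k x \<in> generate G (\<Union>(insert M \<F>))"
      by (rule generate.incl)
  qed
  ultimately show ?case ..
qed

text \<open>Local nilpotence concerns finitely many elements at a time, and these lie in the join of
  finitely many members of the family.\<close>

lemma hirsch_plotkin_Union:
  assumes K: "K \<subseteq> carrier G"
    and F: "\<And>M. M \<in> \<F> \<Longrightarrow> subgroup M G \<and> M \<subseteq> K \<and> normalizes K M \<and> locally_nilpotent_in M"
  shows "locally_nilpotent_in (generate G (\<Union>\<F>))"
  unfolding locally_nilpotent_in_def
proof (intro allI impI)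
  fix S assume S: "finite S \<and> S \<subseteq> generate G (\<Union>\<F>)"
  have Fc: "\<Union>\<F> \<subseteq> carrier G"
    using F K by blast
  obtain T where T: "finite T" "T \<subseteq> \<Union>\<F>" "S \<subseteq> generate G T"
    using finite_subset_generate[OF Fc] S by metis
  obtain \<E> where E: "finite \<E>" "\<E> \<subseteq> \<F>" "T \<subseteq> \<Union>\<E>"
    using finite_subset_Union[OF T(1,2)] by metis
  have "locally_nilpotent_in (generate G (\<Union>\<E>))"
    using hirsch_plotkin_finite_Union[OF E(1) K] F E(2) by blast
  moreover have "S \<subseteq> generate G (\<Union>\<E>)"
    using T(3) mono_generate[OF E(3)] by blast
  ultimately show "nilpotent_in (generate G S)"
    using S unfolding locally_nilpotent_in_def by blast
qed

end

section \<open>Groups stabilizing a series of subgroups\<close>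

context group
begin

definition centralizer :: "'a set \<Rightarrow> 'a set" where
  "centralizer X = {x \<in> carrier G. \<forall>c\<in>X. conjugate c x = x}"

lemma centralizerD:
  "x \<in> centralizer X \<Longrightarrow> x \<in> carrier G" "\<lbrakk>x \<in> centralizer X; c \<in> X\<rbrakk> \<Longrightarrow> conjugate c x = x"
  by (auto simp: centralizer_def)

lemma centralizer_subgroup:
  assumes "X \<subseteq> carrier G" shows "subgroup (centralizer X) G"
  using assms by unfold_locales (auto simp: centralizer_def conj_mult conj_inv subset_iff)

lemma normalizes_centralizer:
  assumes N: "subgroup N G" and X: "X \<subseteq> carrier G" and NX: "normalizes N X"
  shows "normalizes N (centralizer X)"
  unfolding normalizes_def
proof (intro ballI)
  fix n x assume n: "n \<in> N" and x: "x \<in> centralizer X"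
  have nc: "n \<in> carrier G"
    using n subgroup.subset[OF N] by auto
  have xc: "x \<in> carrier G"
    using x by (rule centralizerD)
  have "conjugate c (conjugate n x) = conjugate n x" if c: "c \<in> X" for c
  proof -
    have "conjugate (inv n) c \<in> X"
      using NX subgroup.m_inv_closed[OF N n] c by (rule normalizesD)
    then have "conjugate n (conjugate (conjugate (inv n) c) x) = conjugate n x"
      using x by (simp add: centralizerD)
    moreover have "conjugate n (conjugate (conjugate (inv n) c) x) = conjugate c (conjugate n x)"
      using nc xc c X by (simp add: group_word_simps subsetD)
    ultimately show ?thesis by simp
  qed
  then show "conjugate n x \<in> centralizer X"
    using nc xc by (simp add: centralizer_def)
qed

primrec commutator_series :: "'a set \<Rightarrow> 'a set \<Rightarrow> nat \<Rightarrow> 'a set" where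
  "commutator_series B L 0 = B"
| "commutator_series B L (Suc n) = commutator_subgroup G (commutator_series B L n) L"

end

text \<open>P. Hall's setting: \<open>L\<close> acts on \<open>B\<close> by conjugation and
  stabilizes the series, that is, it acts trivially on the cosets of each term in the preceding one.
  Faithfulness identifies \<open>L\<close> with a group of automorphisms of
  \<open>B\<close>.\<close>

locale stability_group = group +
  fixes B L :: "'a set" and m :: nat
  assumes B: "subgroup B G" and L: "subgroup L G" and L_normalizes_B: "normalizes L B"
    and faithful: "L \<inter> centralizer B \<subseteq> {\<one>}"
    and series_trivial: "commutator_series B L m \<subseteq> {\<one>}"
begin

abbreviation C :: "nat \<Rightarrow> 'a set" where
  "C \<equiv> commutator_series B L"

lemma L_closed: "L \<subseteq> carrier G"
  by (rule subgroup.subset[OF L])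

lemma C_subgroup: "subgroup (C j) G"
  by (induction j) (simp_all add: B L_closed commutator_subgroup_is_subgroup subgroup.subset)

lemma C_closed: "C j \<subseteq> carrier G"
  by (rule subgroup.subset[OF C_subgroup])

lemma L_normalizes_C: "normalizes L (C j)"
  by (induction j)
    (simp_all add: L_normalizes_B normalizes_commutator_subgroup C_closed L_closed
      subgroup_normalizes_self[OF L])

lemma C_Suc_subset: "C (Suc j) \<subseteq> C j"
  unfolding commutator_series.simps
  by (intro commutator_subgroup_minimal C_subgroup comm_in_of_normalizes(1)[OF C_subgroup L_closed]
      L_normalizes_C)

lemma C_antimono: "i \<le> j \<Longrightarrow> C j \<subseteq> C i"
  by (rule lift_Suc_antimono_le[of C]) (rule C_Suc_subset)

lemma C_normalizes_C_Suc: "normalizes (C j) (C (Suc j))"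
  unfolding commutator_series.simps
  by (rule left_normalizes_commutator_subgroup[OF C_subgroup L_closed])

lemma C_trivial: "m \<le> j \<Longrightarrow> C j \<subseteq> {\<one>}"
  using C_antimono[of m j] series_trivial by blast

section \<open>P. Hall's theorem: nilpotence of \<open>L\<close>\<close>

lemma lcs_L_subset: "lcs L n \<subseteq> L"
  using lcs_antimono[OF L, of 0 n] by simp

text \<open>Since \<open>a\<close> centralizes \<open>C (Suc j)\<close>, the map \<open>g \<mapsto> comm g a\<close> is a derivation on \<open>C j\<close> with values
  in the centre of \<open>C (Suc j)\<close>; forming \<open>comm a l\<close> amounts to forming commutators of the values with
  \<open>l\<close>.\<close>

lemma comm_comm_eq:
  assumes g: "g \<in> C j" and a: "a \<in> L" "a \<in> centralizer (C (Suc j))" and l: "l \<in> L"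
  shows "comm g (comm a l) = comm (comm g a) l"
proof -
  let ?Z = "centralizer (C (Suc j))"
  have Z: "subgroup ?Z G"
    by (rule centralizer_subgroup[OF C_closed])
  have Zc: "?Z \<subseteq> carrier G"
    by (rule subgroup.subset[OF Z])
  have CZ: "normalizes (C j) ?Z"
    by (rule normalizes_centralizer[OF C_subgroup C_closed C_normalizes_C_Suc])
  have LZ: "normalizes L ?Z"
    by (rule normalizes_centralizer[OF L C_closed L_normalizes_C])
  have c: "g \<in> carrier G" "a \<in> carrier G" "l \<in> carrier G"
    using g a l C_closed L_closed by auto
  define d e where "d = comm g a" and "e = comm g l"
  have d: "d \<in> C (Suc j)" and e: "e \<in> C (Suc j)"
    unfolding d_def e_def using g a l by (simp_all add: comm_in_commutator_subgroup)
  then have dc: "d \<in> carrier G" and ec: "e \<in> carrier G"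
    using C_closed by blast+
  have dZ: "d \<in> ?Z"
    unfolding d_def using comm_in_of_normalizes(2)[OF Z C_closed CZ a(2) g] .
  \<comment> \<open>\<open>z\<close> is the conjugate of \<open>a\<close> by \<open>g\<close>, and
    \<open>e \<otimes> l\<close> is that of \<open>l\<close>. Since \<open>e\<close> commutes with
    \<open>z\<close> and with \<open>comm z l\<close>, it drops out of the commutator.\<close>
  define z where "z = d \<otimes> a"
  have zZ: "z \<in> ?Z"
    unfolding z_def using dZ a(2) by (rule subgroup.m_closed[OF Z])
  have zc: "z \<in> carrier G"
    using zZ Zc by auto
  have zl: "comm z l \<in> ?Z" and dl: "comm d l \<in> ?Z" and al: "comm a l \<in> ?Z"
    using comm_in_of_normalizes(1)[OF Z L_closed LZ] zZ dZ a l by auto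
  have "comm z e = inv (conjugate e z \<otimes> inv z)"
    using zc ec by (simp add: group_word_simps)
  then have ze: "comm z e = \<one>"
    using centralizerD(2)[OF zZ e] zc by simp
  have "conjugate g (comm a l) = comm z (e \<otimes> l)"
    unfolding z_def d_def e_def using c by (simp add: conj_comm flip: conj_eq_comm_mult)
  also have "\<dots> = conjugate e (comm z l)"
    using zc ec c ze by (simp add: comm_mult_right)
  also have "\<dots> = comm z l"
    by (rule centralizerD(2)[OF zl e])
  also have "\<dots> = conjugate d (comm a l) \<otimes> comm d l"
    unfolding z_def using dc c by (simp add: comm_mult_left)
  also have "\<dots> = comm a l \<otimes> comm d l"
    using centralizerD(2)[OF al d] by simp
  finally have 1: "conjugate g (comm a l) = comm a l \<otimes> comm d l" .
  have "comm d l \<in> C (Suc j)"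
    using comm_in_of_normalizes(1)[OF C_subgroup L_closed L_normalizes_C d l] .
  then have 2: "conjugate (comm d l) (comm a l) = comm a l"
    by (rule centralizerD(2)[OF al])
  have "comm g (comm a l) = comm a l \<otimes> comm d l \<otimes> inv (comm a l)"
    using c by (simp add: comm_eq_mult_conj(2)[of g] 1)
  \<comment> \<open>\<open>comm a l\<close> is replaced by its conjugate under
    \<open>comm d l\<close>, with which it commutes; then the product cancels.\<close>
  also have "\<dots> = conjugate (comm d l) (comm a l) \<otimes> comm d l \<otimes> inv (comm a l)"
    using 2 by simp
  also have "\<dots> = comm d l"
    using c dc by (simp add: conjugate_def m_assoc del: inv_mult_group)
  finally show ?thesis
    by (simp add: d_def)
qed

text \<open>By \<open>comm_comm_eq\<close>, one more commutator of \<open>a\<close> with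
  \<open>L\<close> becomes one more commutator of the value with \<open>L\<close>, so each step down
  the lower central series of \<open>L\<close> gains a step of the series \<open>C\<close>.\<close>

lemma comm_lcs_in_C:
  assumes n: "lcs L n \<subseteq> centralizer (C (Suc j))"
  shows "\<lbrakk>a \<in> lcs L (n + i); g \<in> C j\<rbrakk> \<Longrightarrow> comm g a \<in> C (Suc j + i)"
proof (induction i arbitrary: a g)
  case 0
  then show ?case
    using lcs_L_subset by (auto intro: comm_in_commutator_subgroup)
next
  case (Suc i)
  \<comment> \<open>\<open>?D\<close> is a subgroup, so only the generators \<open>comm a l\<close>
    of the next term have to be checked.\<close>
  let ?D = "{a \<in> L. \<forall>g\<in>C j. comm g a \<in> C (Suc j + Suc i)}"
  note CD = subgroup.m_closed[OF C_subgroup] subgroup.m_inv_closed[OF C_subgroup]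
    subgroup.one_closed[OF C_subgroup]
  have "subgroup ?D G"
  proof
    show "?D \<subseteq> carrier G"
      using L_closed by auto
    have "comm g \<one> \<in> C (Suc j + Suc i)" if "g \<in> C j" for g
    proof -
      have "g \<in> carrier G"
        using that C_closed by blast
      then show ?thesis
        using CD(3)[of "Suc j + Suc i"] by (simp del: commutator_series.simps)
    qed
    then show "\<one> \<in> ?D"
      using subgroup.one_closed[OF L] by simp
    fix x assume x: "x \<in> ?D"
    then have xL: "x \<in> L" "inv x \<in> L" "x \<in> carrier G"
      using subgroup.m_inv_closed[OF L] L_closed by auto
    have "comm g (inv x) \<in> C (Suc j + Suc i)" if "g \<in> C j" for g
    proof -
      have "comm g (inv x) = conjugate (inv x) (inv (comm g x))"
        using that C_closed xL by (intro comm_inv_right) auto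
      then show ?thesis
        using x that CD(2) normalizesD[OF L_normalizes_C xL(2)] by (simp del: commutator_series.simps)
    qed
    then show "inv x \<in> ?D"
      using xL by simp
    fix y assume y: "y \<in> ?D"
    then have yL: "y \<in> L" "y \<in> carrier G"
      using L_closed by auto
    have "comm g (x \<otimes> y) \<in> C (Suc j + Suc i)" if "g \<in> C j" for g
    proof -
      have "comm g (x \<otimes> y) = comm g x \<otimes> conjugate x (comm g y)"
        using that C_closed xL yL by (intro comm_mult_right) auto
      then show ?thesis
        using x y that CD(1) normalizesD[OF L_normalizes_C xL(1)]
        by (simp del: commutator_series.simps)
    qed
    then show "x \<otimes> y \<in> ?D"
      using xL yL subgroup.m_closed[OF L] by simp
  qed
  moreover have "comm a l \<in> ?D" if a: "a \<in> lcs L (n + i)" and l: "l \<in> L" for a l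
  proof -
    have aL: "a \<in> L" and aZ: "a \<in> centralizer (C (Suc j))"
      using a lcs_L_subset n lcs_antimono[OF L, of n "n + i"] by auto
    have "comm g (comm a l) \<in> C (Suc j + Suc i)" if "g \<in> C j" for g
      using comm_comm_eq[OF that aL aZ l] comm_in_commutator_subgroup[OF Suc.IH[OF a that] l] by simp
    then show ?thesis
      using comm_in_of_normalizes(1)[OF L L_closed subgroup_normalizes_self[OF L] aL l] by simp
  qed
  ultimately have "lcs L (Suc (n + i)) \<subseteq> ?D"
    unfolding lcs.simps by (rule commutator_subgroup_minimal)
  then show ?case
    using Suc.prems by auto
qed

text \<open>Induction up the series, from the trivial \<open>C m\<close> to \<open>C 0 = B\<close>,
  which is reached at \<open>k = m\<close>.\<close>

lemma lcs_centralizes_C: "\<exists>n. lcs L n \<subseteq> centralizer (C (m - k))"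
proof (induction k)
  case 0
  have "lcs L 0 \<subseteq> centralizer (C m)"
    unfolding centralizer_def using L_closed series_trivial one_conj by fastforce
  then show ?case by (intro exI[of _ 0]) simp
next
  case (Suc k)
  then obtain n where n: "lcs L n \<subseteq> centralizer (C (m - k))" by blast
  show ?case
  proof (cases "k < m")
    case False
    then show ?thesis using n by auto
  next
    case True
    define j where "j = m - Suc k"
    have j: "m - k = Suc j"
      using True by (simp add: j_def)
    \<comment> \<open>After \<open>m\<close> further commutators with \<open>L\<close> the values
      \<open>comm g a\<close> lie in \<open>C (Suc j + m)\<close>, which is trivial.\<close>
    have "lcs L (n + m) \<subseteq> centralizer (C j)"
    proof
      fix a assume a: "a \<in> lcs L (n + m)"
      have ac: "a \<in> carrier G"
        using a lcs_L_subset L_closed by blast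
      have "conjugate g a = a" if g: "g \<in> C j" for g
      proof -
        have "comm g a \<in> C (Suc j + m)"
          using comm_lcs_in_C[OF _ a g] n j by simp
        then have "comm g a = \<one>"
          using C_trivial[of "Suc j + m"] by auto
        moreover have "conjugate g a = comm g a \<otimes> a"
          using g C_closed ac by (intro conj_eq_comm_mult) auto
        ultimately show ?thesis
          using ac by simp
      qed
      then show "a \<in> centralizer (C j)"
        using ac by (simp add: centralizer_def)
    qed
    then show ?thesis
      unfolding j_def by blast
  qed
qed

text \<open>A term of the lower central series of \<open>L\<close> that centralizes
  \<open>C 0 = B\<close> is trivial by faithfulness.\<close>

lemma nilpotent_L: "nilpotent_in L"
proof -
  obtain n where "lcs L n \<subseteq> centralizer B"
    using lcs_centralizes_C[of m] by auto
  then show ?thesis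
    unfolding nilpotent_in_def using faithful lcs_L_subset by blast
qed

section \<open>Local nilpotence of the products of \<open>C j\<close> and \<open>L\<close>\<close>

definition K :: "nat \<Rightarrow> 'a set" where
  "K j = generate G (C j \<union> L)"

lemma CL_closed: "C j \<union> L \<subseteq> carrier G"
  using C_closed L_closed by simp

lemma K_subgroup: "subgroup (K j) G"
  unfolding K_def by (rule generate_is_subgroup[OF CL_closed])

lemma K_closed: "K j \<subseteq> carrier G"
  by (rule subgroup.subset[OF K_subgroup])

lemma C_subset_K: "C j \<subseteq> K j" and L_subset_K: "L \<subseteq> K j"
  unfolding K_def by (auto intro: generate.incl)

lemma K_Suc_subset: "K (Suc j) \<subseteq> K j"
  unfolding K_def using C_Suc_subset by (intro mono_generate) blast

text \<open>For \<open>y\<close> in \<open>L\<close> the conjugate is \<open>[x, y] y\<close> with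
  \<open>[x, y]\<close> in \<open>C (Suc j)\<close>.\<close>

lemma C_normalizes_K_Suc: "normalizes (C j) (K (Suc j))"
  unfolding K_def
proof (rule normalizes_generate[OF CL_closed C_closed], fold K_def)
  fix x y assume x: "x \<in> C j" and y: "y \<in> C (Suc j) \<union> L"
  show "conjugate x y \<in> K (Suc j)"
  proof (cases "y \<in> L")
    case True
    then have "comm x y \<in> K (Suc j)" "y \<in> K (Suc j)"
      using comm_in_commutator_subgroup[OF x True] C_subset_K[of "Suc j"] L_subset_K by auto
    moreover have "conjugate x y = comm x y \<otimes> y"
      using x True C_closed L_closed by (intro conj_eq_comm_mult) auto
    ultimately show ?thesis
      by (simp add: subgroup.m_closed[OF K_subgroup])
  next
    case False
    then show ?thesis
      using normalizesD[OF C_normalizes_C_Suc x, of y] y C_subset_K[of "Suc j"] by auto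
  qed
qed

lemma K_normalizes_K_Suc: "normalizes (K j) (K (Suc j))"
proof -
  have *: "normalizes (C j \<union> L) (K (Suc j))"
    using C_normalizes_K_Suc normalizes_mono[OF subgroup_normalizes_self[OF K_subgroup] L_subset_K]
    by (auto simp: normalizes_def)
  have "m_inv G ` (C j \<union> L) \<subseteq> C j \<union> L"
    using subgroup.m_inv_closed[OF C_subgroup] subgroup.m_inv_closed[OF L] by blast
  then show ?thesis
    unfolding K_def[of j] by (intro generate_normalizes CL_closed K_closed *) (rule normalizes_mono[OF *])
qed

text \<open>The conjugates of \<open>K (Suc (Suc j))\<close> under \<open>C j\<close> are normal in
  \<open>K (Suc j)\<close>, because \<open>C j\<close> normalizes \<open>K (Suc j)\<close>. They
  generate it, because \<open>[x, l]\<close> is the product of \<open>x l x^-1\<close> and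
  \<open>l^-1\<close>. The Hirsch-Plotkin theorem for families applies.\<close>

lemma locally_nilpotent_K_step:
  assumes ln: "locally_nilpotent_in (K (Suc (Suc j)))"
  shows "locally_nilpotent_in (K (Suc j))"
proof -
  let ?M = "\<lambda>x. conjugate x ` K (Suc (Suc j))"
  let ?F = "?M ` C j"
  have "subgroup M G \<and> M \<subseteq> K (Suc j) \<and> normalizes (K (Suc j)) M \<and> locally_nilpotent_in M"
    if F: "M \<in> ?F" for M
  proof -
    obtain x where x: "x \<in> C j" and M: "M = ?M x"
      using F by blast
    have xc: "x \<in> carrier G" and ix: "inv x \<in> C j"
      using x C_closed subgroup.m_inv_closed[OF C_subgroup] by auto
    interpret h: group_hom G G "conjugate x"
      using xc by unfold_locales (auto simp: hom_def conj_mult)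
    have "normalizes (K (Suc j)) M"
      unfolding normalizes_def
    proof (intro ballI)
      fix k y assume k: "k \<in> K (Suc j)" and "y \<in> M"
      then obtain z where z: "z \<in> K (Suc (Suc j))" "y = conjugate x z"
        by (auto simp: M)
      have c: "k \<in> carrier G" "z \<in> carrier G"
        using k z K_closed by auto
      have "conjugate (inv x) k \<in> K (Suc j)"
        using C_normalizes_K_Suc ix k by (rule normalizesD)
      then have "conjugate (conjugate (inv x) k) z \<in> K (Suc (Suc j))"
        using K_normalizes_K_Suc z(1) normalizesD by blast
      \<comment> \<open>Conjugation by \<open>k\<close> is moved past \<open>x\<close>, where it
        becomes conjugation by the element \<open>x^-1 k x\<close> of
        \<open>K (Suc j)\<close>.\<close>
      moreover have "conjugate k y = conjugate x (conjugate (conjugate (inv x) k) z)"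
        unfolding z using xc c by (simp add: group_word_simps)
      ultimately show "conjugate k y \<in> M"
        by (simp add: M)
    qed
    moreover have "M \<subseteq> K (Suc j)"
      using normalizesD[OF C_normalizes_K_Suc x] K_Suc_subset by (auto simp: M)
    ultimately show ?thesis
      using h.subgroup_img_is_subgroup[OF K_subgroup] locally_nilpotent_in_conj[OF xc K_closed ln] M
      by simp
  qed
  note F = this
  have "locally_nilpotent_in (generate G (\<Union>?F))"
    using hirsch_plotkin_Union[OF K_closed F] .
  moreover have "K (Suc j) \<subseteq> generate G (\<Union>?F)"
  proof -
    have "\<Union>?F \<subseteq> carrier G"
      using F K_closed by blast
    then have S: "subgroup (generate G (\<Union>?F)) G"
      by (rule generate_is_subgroup)
    have conj_F: "conjugate x l \<in> generate G (\<Union>?F)" if "x \<in> C j" "l \<in> L" for x l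
      using that L_subset_K by (blast intro: generate.incl)
    have L_F: "L \<subseteq> generate G (\<Union>?F)"
    proof
      fix l assume l: "l \<in> L"
      then show "l \<in> generate G (\<Union>?F)"
        using conj_F[OF subgroup.one_closed[OF C_subgroup] l] L_closed by (simp add: subsetD)
    qed
    have "C (Suc j) \<subseteq> generate G (\<Union>?F)"
      unfolding commutator_series.simps
    proof (rule commutator_subgroup_minimal[OF S])
      fix x l assume x: "x \<in> C j" and l: "l \<in> L"
      have "comm x l = conjugate x l \<otimes> inv l"
        using x l C_closed L_closed by (intro comm_eq_mult_conj(2)) auto
      moreover have "inv l \<in> generate G (\<Union>?F)"
        using L_F subgroup.m_inv_closed[OF L l] by blast
      ultimately show "comm x l \<in> generate G (\<Union>?F)"
        using conj_F[OF x l] by (simp add: generate.eng)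
    qed
    then show ?thesis
      unfolding K_def[of "Suc j"] using L_F by (intro generate_subgroup_incl[OF _ S] Un_least)
  qed
  ultimately show ?thesis
    by (rule locally_nilpotent_in_mono)
qed

text \<open>The climb starts at \<open>K (Suc m)\<close>, which lies in the nilpotent group
  \<open>L\<close>, and reaches \<open>K 1\<close> at \<open>k = m\<close>.\<close>

lemma locally_nilpotent_K: "locally_nilpotent_in (K (Suc (m - k)))"
proof (induction k)
  case 0
  have "K (Suc m) \<subseteq> L"
    unfolding K_def using C_trivial[of "Suc m"] subgroup.one_closed[OF L]
    by (intro generate_subgroup_incl L) auto
  then show ?case
    using locally_nilpotent_in_mono nilpotent_imp_locally_nilpotent_in[OF L nilpotent_L] by simp
next
  case (Suc k)
  show ?case
  proof (cases "k < m")
    case True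
    then show ?thesis
      using Suc locally_nilpotent_K_step[of "m - Suc k"] by (simp add: Suc_diff_Suc)
  qed (use Suc in simp)
qed

lemma locally_nilpotent_commutator: "locally_nilpotent_in (commutator_subgroup G B L)"
  using locally_nilpotent_K[of m] C_subset_K[of "Suc 0"] locally_nilpotent_in_mono by simp

lemma locally_nilpotent_L: "locally_nilpotent_in L"
  by (rule nilpotent_imp_locally_nilpotent_in[OF L nilpotent_L])

end

section \<open>Transfer along injective homomorphisms\<close>

lemma (in group) lower_central_series_eq_lcs: "lower_central_series G n = lcs (carrier G) n"
  by (induction n) simp_all

lemma (in group_hom) img_lcs:
  assumes X: "subgroup X G"
  shows "h ` G.lcs X n \<subseteq> H.lcs (h ` X) n"
proof (induction n)
  case (Suc n)
  let ?C = "{G.comm x y | x y. x \<in> G.lcs X n \<and> y \<in> X}"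
  have c: "G.lcs X n \<subseteq> carrier G" "X \<subseteq> carrier G"
    using subgroup.subset[OF X] subgroup.subset[OF G.lcs_subgroup[OF X]] by auto
  then have C: "?C \<subseteq> carrier G"
    by (rule G.commutators_closed)
  have img_comm: "h (G.comm x y) = H.comm (h x) (h y)" if "x \<in> carrier G" "y \<in> carrier G" for x y
    using that by (simp add: G.comm_def H.comm_def)
  have "h ` ?C \<subseteq> {H.comm x y | x y. x \<in> H.lcs (h ` X) n \<and> y \<in> h ` X}"
    using Suc.IH c img_comm by blast
  then have "generate H (h ` ?C) \<subseteq> H.lcs (h ` X) (Suc n)"
    unfolding H.lcs.simps H.commutator_subgroup_alt by (rule H.mono_generate)
  then show ?case
    using generate_img[OF C] by (simp add: G.commutator_subgroup_alt)
qed simp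

text \<open>A term of the lower central series of a finitely generated subgroup is mapped into the
  corresponding term of its image; once that is trivial, injectivity makes the original
  trivial.\<close>

lemma (in group_hom) locally_nilpotent_group_of_inj:
  assumes inj: "inj_on h (carrier G)" and X: "h ` carrier G \<subseteq> X"
    and ln: "H.locally_nilpotent_in X"
  shows "locally_nilpotent_group G"
  unfolding locally_nilpotent_group_def
proof (intro conjI allI impI)
  fix S assume S: "finite S \<and> S \<subseteq> carrier G"
  let ?Z = "subgroup_generated G S"
  have Zc: "carrier ?Z = generate G S"
    using S by (simp add: carrier_subgroup_generated Int_absorb1)
  interpret Z: group_hom ?Z H h
    by (intro group_hom.intro group_hom_axioms.intro G.group_subgroup_generated H.is_group
        G.hom_from_subgroup_generated[OF homh])
  have hS: "h ` carrier ?Z = generate H (h ` S)"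
    using S generate_img by (simp add: Zc)
  have "H.nilpotent_in (generate H (h ` S))"
    using ln X S unfolding H.locally_nilpotent_in_def by (meson finite_imageI image_mono order_trans)
  then obtain n where n: "H.lcs (generate H (h ` S)) n \<subseteq> {\<one>\<^bsub>H\<^esub>}"
    unfolding H.nilpotent_in_def by blast
  let ?L = "lower_central_series ?Z n"
  have L: "subgroup ?L ?Z"
    unfolding Z.G.lower_central_series_eq_lcs by (rule Z.G.lcs_subgroup[OF Z.G.subgroup_self])
  have "h ` ?L \<subseteq> {\<one>\<^bsub>H\<^esub>}"
    using Z.img_lcs[OF Z.G.subgroup_self, of n] n
    unfolding Z.G.lower_central_series_eq_lcs hS by blast
  moreover have "?L \<subseteq> carrier G"
    using subgroup.subset[OF L] G.carrier_subgroup_generated_subset by blast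
  ultimately have "?L \<subseteq> {\<one>\<^bsub>G\<^esub>}"
    using inj by (auto simp: inj_on_one_iff)
  then have "?L = {\<one>\<^bsub>?Z\<^esub>}"
    using subgroup.one_closed[OF L] by auto
  then show "nilpotent_group ?Z"
    unfolding nilpotent_group_def using Z.G.is_group by blast
qed (rule G.is_group)


section \<open>Translations and lambda maps as permutations of a skew left brace\<close>

context skew_left_brace
begin

abbreviation Sym :: "('a \<Rightarrow> 'a) monoid" where
  "Sym \<equiv> BijGroup (carrier A)"

text \<open>The left regular representation of the additive group; the restriction makes it
  extensional, as elements of \<open>BijGroup\<close> are.\<close>

definition transl :: "'a \<Rightarrow> 'a \<Rightarrow> 'a" where
  "transl b = (\<lambda>x \<in> carrier A. b \<oplus> x)"

lemma transl_Bij: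
  assumes "b \<in> carrier A" shows "transl b \<in> Bij (carrier A)"
proof -
  have "bij_betw (transl b) (carrier A) (carrier A)"
    by (rule bij_betw_byWitness[where f' = "transl (\<ominus> b)"])
      (use assms in \<open>auto simp: transl_def a_simps\<close>)
  then show ?thesis
    by (simp add: Bij_def transl_def)
qed

lemma lambda_map_Bij: "a \<in> carrier A \<Longrightarrow> lambda_map A a \<in> Bij (carrier A)"
  using lambda_map_auto by (simp add: auto_def)

lemma group_hom_transl: "group_hom (add_monoid A) Sym transl"
proof (intro group_hom.intro group_hom_axioms.intro homI)
  fix x y assume xy: "x \<in> carrier (add_monoid A)" "y \<in> carrier (add_monoid A)"
  then have "transl (x \<oplus> y) = compose (carrier A) (transl x) (transl y)"
    by (auto simp: transl_def compose_def a_simps)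
  then show "transl (x \<otimes>\<^bsub>add_monoid A\<^esub> y) = transl x \<otimes>\<^bsub>Sym\<^esub> transl y"
    using xy by (simp add: BijGroup_def transl_Bij)
qed (simp_all add: BijGroup_def transl_Bij add.is_group group_BijGroup[unfolded BijGroup_def])

lemma lambda_map_hom_Sym: "group_hom A Sym (lambda_map A)"
proof (intro group_hom.intro group_hom_axioms.intro)
  show "lambda_map A \<in> hom A Sym"
    using lambda_map_hom by (auto simp: hom_def AutoGroup_def BijGroup_def lambda_map_Bij)
qed (simp_all add: is_group group_BijGroup)

lemma transl_inj: "inj_on transl (carrier A)"
proof (rule inj_onI)
  fix x y assume xy: "x \<in> carrier A" "y \<in> carrier A" "transl x = transl y"
  then have "transl x \<zero> = transl y \<zero>" by simp
  then show "x = y"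
    using xy by (simp add: transl_def a_simps)
qed

interpretation Sym: group Sym
  by (rule group_BijGroup)

interpretation tr: group_hom "add_monoid A" Sym transl
  by (rule group_hom_transl)

interpretation lam: group_hom A Sym "lambda_map A"
  by (rule lambda_map_hom_Sym)

text \<open>By additivity, \<open>lambda_map A a\<close> after translation by \<open>b\<close> is
  translation by \<open>lambda_map A a b\<close> after \<open>lambda_map A a\<close>.\<close>

lemma conjugate_transl:
  assumes a: "a \<in> carrier A" and b: "b \<in> carrier A"
  shows "Sym.conjugate (lambda_map A a) (transl b) = transl (lambda_map A a b)"
proof -
  have "lambda_map A a \<otimes>\<^bsub>Sym\<^esub> transl b = compose (carrier A) (lambda_map A a) (transl b)"
    using assms by (simp add: BijGroup_def lambda_map_Bij transl_Bij)
  also have "\<dots> = compose (carrier A) (transl (lambda_map A a b)) (lambda_map A a)"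
    by (rule extensionalityI[of _ "carrier A"])
      (use assms in \<open>auto simp: compose_def transl_def lambda_map_add lambda_map_closed\<close>)
  also have "\<dots> = transl (lambda_map A a b) \<otimes>\<^bsub>Sym\<^esub> lambda_map A a"
    using assms by (simp add: BijGroup_def lambda_map_Bij transl_Bij lambda_map_closed)
  finally have "lambda_map A a \<otimes>\<^bsub>Sym\<^esub> transl b = transl (lambda_map A a b) \<otimes>\<^bsub>Sym\<^esub> lambda_map A a" .
  then show ?thesis
    using lam.hom_closed[OF a] tr.hom_closed[of "lambda_map A a b"] lambda_map_closed[OF a b]
    by (simp add: Sym.conjugate_def Sym.m_assoc)
qed

text \<open>\<open>star A a b\<close> is \<open>lambda_map A a b \<ominus> b\<close>, which is the
  commutator with the lambda map first. The inverse comes from exchanging the arguments to match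
  \<open>commutator_series\<close>.\<close>

lemma comm_transl_lambda_map:
  assumes a: "a \<in> carrier A" and b: "b \<in> carrier A"
  shows "Sym.comm (transl b) (lambda_map A a) = inv\<^bsub>Sym\<^esub> (transl (star A a b))"
proof -
  have c: "transl b \<in> carrier Sym" "lambda_map A a \<in> carrier Sym" "transl (lambda_map A a b) \<in> carrier Sym"
    using lam.hom_closed[OF a] tr.hom_closed b lambda_map_closed[OF a b] by auto
  have "Sym.comm (lambda_map A a) (transl b) = transl (lambda_map A a b) \<otimes>\<^bsub>Sym\<^esub> inv\<^bsub>Sym\<^esub> (transl b)"
    using c by (simp add: Sym.comm_eq_mult_conj(2) conjugate_transl[OF a b])
  also have "\<dots> = transl (lambda_map A a b \<oplus> \<ominus> b)"
    using tr.hom_inv[of b] tr.hom_mult[of "lambda_map A a b" "\<ominus> b"] lambda_map_closed[OF a b] b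
    by (simp add: a_inv_def neg_closed[unfolded a_inv_def])
  also have "lambda_map A a b \<oplus> \<ominus> b = star A a b"
    using b by (simp add: lambda_map_def star_def a_minus_def)
  finally show ?thesis
    using c Sym.inv_comm by metis
qed

section \<open>The left series as a commutator series\<close>

lemma left_series_subgroup: "subgroup (left_series A n) (add_monoid A)"
proof (induction n)
  case 0
  then show ?case using add.subgroup_self by simp
next
  case (Suc n)
  show ?case
  proof (cases n)
    case 0
    then show ?thesis using add.subgroup_self by simp
  next
    case (Suc k)
    have "left_series A n \<subseteq> carrier A"
      using subgroup.subset[OF Suc.IH] by simp
    then have "{star A x y | x y. x \<in> carrier A \<and> y \<in> left_series A n} \<subseteq> carrier (add_monoid A)"
      by (auto simp: star_def a_minus_def a_simps subset_iff)
    then show ?thesis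
      using add.generate_is_subgroup Suc by (simp add: star_set_def)
  qed
qed

text \<open>The shift of the index is due to the left series starting at 1. The inclusion is enough
  to reach the trivial group.\<close>

lemma commutator_series_transl:
  "Sym.commutator_series (transl ` carrier A) (lambda_map A ` carrier A) n
    \<subseteq> transl ` left_series A (Suc n)"
proof (induction n)
  case (Suc n)
  show ?case
    unfolding Sym.commutator_series.simps
  proof (rule Sym.commutator_subgroup_minimal)
    show "subgroup (transl ` left_series A (Suc (Suc n))) Sym"
      by (rule tr.subgroup_img_is_subgroup[OF left_series_subgroup])
    then show "Sym.comm g l \<in> transl ` left_series A (Suc (Suc n))"
      if "g \<in> Sym.commutator_series (transl ` carrier A) (lambda_map A ` carrier A) n"
        and "l \<in> lambda_map A ` carrier A" for g l
    proof -
      obtain b where b: "b \<in> left_series A (Suc n)" "g = transl b"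
        using Suc \<open>g \<in> _\<close> by blast
      obtain a where a: "a \<in> carrier A" "l = lambda_map A a"
        using \<open>l \<in> _\<close> by blast
      have "b \<in> carrier A"
        using b subgroup.subset[OF left_series_subgroup] by auto
      moreover have "star A a b \<in> left_series A (Suc (Suc n))"
        using a b by (auto simp: star_set_def intro: generate.incl)
      ultimately show ?thesis
        using a b subgroup.m_inv_closed[OF \<open>subgroup _ Sym\<close>]
        by (simp add: comm_transl_lambda_map del: left_series.simps)
    qed
  qed
qed simp

text \<open>The converse inclusion at the first step, needed to inherit local nilpotence from the
  commutator subgroup of translations and lambda maps.\<close>

lemma left_series_2_transl:
  "transl ` left_series A 2
    \<subseteq> commutator_subgroup Sym (transl ` carrier A) (lambda_map A ` carrier A)"
proof -
  let ?S = "{star A x y |x y. x \<in> carrier A \<and> y \<in> carrier A}"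
  have sub: "subgroup (commutator_subgroup Sym (transl ` carrier A) (lambda_map A ` carrier A)) Sym"
    using tr.hom_closed lam.hom_closed by (intro Sym.commutator_subgroup_is_subgroup) auto
  have S: "?S \<subseteq> carrier (add_monoid A)"
    by (auto simp: star_def a_minus_def a_simps)
  have "transl (star A x y) \<in> commutator_subgroup Sym (transl ` carrier A) (lambda_map A ` carrier A)"
    if xy: "x \<in> carrier A" "y \<in> carrier A" for x y
  proof -
    have "transl (star A x y) \<in> carrier Sym"
      using xy S tr.hom_closed by blast
    then have "transl (star A x y) = inv\<^bsub>Sym\<^esub> (Sym.comm (transl y) (lambda_map A x))"
      by (simp add: comm_transl_lambda_map xy)
    then show ?thesis
      using subgroup.m_inv_closed[OF sub Sym.comm_in_commutator_subgroup] xy by simp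
  qed
  then have "generate Sym (transl ` ?S)
      \<subseteq> commutator_subgroup Sym (transl ` carrier A) (lambda_map A ` carrier A)"
    by (intro Sym.generate_subgroup_incl[OF _ sub]) blast
  then show ?thesis
    using tr.generate_img[OF S] by (simp add: numeral_2_eq_2 star_set_def)
qed

text \<open>Faithfulness holds because a lambda map commuting with all translations satisfies
  \<open>transl (lambda_map A a b) = transl b\<close>, hence fixes every \<open>b\<close>.\<close>

lemma lambda_map_stability_group:
  assumes "left_series A (Suc m) = {\<zero>}"
  shows "stability_group Sym (transl ` carrier A) (lambda_map A ` carrier A) m"
proof (intro stability_group.intro stability_group_axioms.intro group_BijGroup)
  show "subgroup (transl ` carrier A) Sym" "subgroup (lambda_map A ` carrier A) Sym"
    using tr.subgroup_img_is_subgroup[OF add.subgroup_self] lam.subgroup_img_is_subgroup[OF subgroup_self]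
    by simp_all
  show "Sym.normalizes (lambda_map A ` carrier A) (transl ` carrier A)"
    by (auto simp: Sym.normalizes_def conjugate_transl lambda_map_closed)
  show "Sym.commutator_series (transl ` carrier A) (lambda_map A ` carrier A) m \<subseteq> {\<one>\<^bsub>Sym\<^esub>}"
    using commutator_series_transl[of m] tr.hom_one by (simp add: assms del: left_series.simps)
  show "lambda_map A ` carrier A \<inter> Sym.centralizer (transl ` carrier A) \<subseteq> {\<one>\<^bsub>Sym\<^esub>}"
  proof
    fix l assume l: "l \<in> lambda_map A ` carrier A \<inter> Sym.centralizer (transl ` carrier A)"
    then obtain a where a: "a \<in> carrier A" "l = lambda_map A a"
      by blast
    have lc: "l \<in> carrier Sym"
      using a lam.hom_closed by simp
    have "lambda_map A a b = b" if b: "b \<in> carrier A" for b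
    proof -
      have tc: "transl b \<in> carrier Sym"
        using b tr.hom_closed by simp
      have "Sym.conjugate (transl b) l = l"
        using l b Sym.centralizerD(2) by blast
      then have "Sym.comm (transl b) l = \<one>\<^bsub>Sym\<^esub>"
        using tc lc by (simp add: Sym.comm_eq_mult_conj(2))
      then have "Sym.comm l (transl b) = \<one>\<^bsub>Sym\<^esub>"
        using Sym.inv_comm[OF tc lc] by simp
      then have "transl (lambda_map A a b) = transl b"
        using Sym.conj_eq_comm_mult[OF lc tc] tc conjugate_transl[OF a(1) b] a(2) by simp
      then show ?thesis
        using transl_inj lambda_map_closed[OF a(1) b] b by (simp add: inj_on_eq_iff)
    qed
    \<comment> \<open>The neutral element of \<open>BijGroup\<close> is the identity restricted to
      the carrier.\<close>
    then have "lambda_map A a = (\<lambda>x\<in>carrier A. x)"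
      by (intro extensionalityI[of _ "carrier A"]) (auto simp: lambda_map_def)
    then show "l \<in> {\<one>\<^bsub>Sym\<^esub>}"
      by (simp add: a BijGroup_def)
  qed
qed

section \<open>Transfer of local nilpotence back to the brace\<close>

lemma locally_nilpotent_additive:
  assumes "left_series A (Suc m) = {\<zero>}"
  shows "locally_nilpotent_group ((add_monoid A)\<lparr>carrier := left_series A 2\<rparr>)"
proof -
  let ?G = "(add_monoid A)\<lparr>carrier := left_series A 2\<rparr>"
  interpret stability_group Sym "transl ` carrier A" "lambda_map A ` carrier A" m
    by (rule lambda_map_stability_group[OF assms])
  have sub: "left_series A 2 \<subseteq> carrier A"
    using subgroup.subset[OF left_series_subgroup, of 2] by simp
  interpret h: group_hom ?G Sym transl
  proof (intro group_hom.intro group_hom_axioms.intro)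
    show "group ?G"
      by (rule add.subgroup_imp_group[OF left_series_subgroup])
    show "transl \<in> hom ?G Sym"
      using tr.homh sub by (auto simp: hom_def)
  qed (rule Sym.is_group)
  show ?thesis
    using h.locally_nilpotent_group_of_inj locally_nilpotent_commutator left_series_2_transl
      inj_on_subset[OF transl_inj sub] by simp
qed

text \<open>As in the first isomorphism theorem, the quotient embeds into the symmetric group with
  image in the nilpotent group of lambda maps.\<close>

lemma locally_nilpotent_mult_Mod_kernel:
  assumes "left_series A (Suc m) = {\<zero>}"
  shows "locally_nilpotent_group (A Mod kernel A (AutoGroup (add_monoid A)) (lambda_map A))"
proof -
  \<comment> \<open>\<open>AutoGroup\<close> only restricts the carrier of \<open>BijGroup\<close>,
    so the neutral elements and hence the kernels agree.\<close>
  have ker: "kernel A (AutoGroup (add_monoid A)) (lambda_map A) = kernel A Sym (lambda_map A)"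
    by (simp add: kernel_def AutoGroup_def)
  let ?Q = "A Mod kernel A Sym (lambda_map A)"
  interpret stability_group Sym "transl ` carrier A" "lambda_map A ` carrier A" m
    by (rule lambda_map_stability_group[OF assms])
  interpret h: group_hom ?Q Sym "\<lambda>X. the_elem (lambda_map A ` X)"
    by (intro group_hom.intro group_hom_axioms.intro lam.FactGroup_hom Sym.is_group
        normal.factorgroup_is_group lam.normal_kernel)
  have "(\<lambda>X. the_elem (lambda_map A ` X)) ` carrier ?Q \<subseteq> lambda_map A ` carrier A"
  proof
    fix y assume "y \<in> (\<lambda>X. the_elem (lambda_map A ` X)) ` carrier ?Q"
    then obtain a where a: "a \<in> carrier A"
      and y: "y = the_elem (lambda_map A ` (kernel A Sym (lambda_map A) #> a))"
      by (auto simp: FactGroup_def RCOSETS_def)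
    \<comment> \<open>All elements of a coset of the kernel have the same image, which
      \<open>the_elem\<close> extracts.\<close>
    have "lambda_map A ` (kernel A Sym (lambda_map A) #> a) = {lambda_map A a}"
      using a lam.hom_one by (force simp: kernel_def r_coset_def lam.hom_mult)
    then show "y \<in> lambda_map A ` carrier A"
      using a y by simp
  qed
  then show ?thesis
    unfolding ker
    using h.locally_nilpotent_group_of_inj[OF lam.FactGroup_inj_on] locally_nilpotent_L by blast
qed

end

theorem theorem4p6:
  fixes A :: "('a, 'b) ring_scheme"
  assumes "skew_left_brace A" and "left_nilpotent A"
  shows "locally_nilpotent_group ((add_monoid A)\<lparr>carrier := left_series A 2\<rparr>) \<and>
    locally_nilpotent_group (A Mod kernel A (AutoGroup (add_monoid A)) (lambda_map A))"
proof -
  interpret skew_left_brace A by fact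
  \<comment> \<open>\<open>left_nilpotent\<close> demands an index of at least 1, so the index is a
    successor.\<close>
  obtain m where "left_series A (Suc m) = {\<zero>\<^bsub>A\<^esub>}"
    using assms(2) unfolding left_nilpotent_def by (metis One_nat_def Suc_le_D)
  then show ?thesis
    using locally_nilpotent_additive locally_nilpotent_mult_Mod_kernel by blast
qed

end
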